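(* Let $h$ be the fractal Gaussian free field (FGFF) on the Sierpinski gasket $K$. For any $n\ge1$ and any $w\in\{1,2,3\}^n$, the random field $$h^w:=h\circ F_w^{-1},$$ defined in the distributional sense by $\langle h^w,u\rangle_{H^{-\varepsilon}(K_w),H^{\varepsilon}(K_w)}:=3^{-n}\langle h,u\circ F_w\rangle_{H^{-\varepsilon}(K),H^{\varepsilon}(K)}$ for $u\in H^\varepsilon(K_w)$ ($\varepsilon>0$), is the FGFF on $K_w:=F_w(K)$.
   Context: Sierpinski gasket: $V_0=\{p_1,p_2,p_3\}\subset\mathbb{R}^2$ are the vertices of an equilateral triangle of side length one, $F_i(p)=\frac12(p-p_i)+p_i$, and $K$ is the unique non-empty compact set with $K=\bigcup_{i=1}^3F_i(K)$. For a word $w=w_1\ldots w_m\in\{1,2,3\}^m$, $F_w=F_{w_1}\circ\cdots\circ F_{w_m}$. $K$ carries the Euclidean metric $d$ and the self-similar Borel probability measure $\mu$ with $\mu(F_w(K))=3^{-m}$ for all $w\in\{1,2,3\}^m$. Put $d_H=\frac{\log 3}{\log 2}$, $d_W=\frac{\log 5}{\log 2}$, $d_S=\frac{2d_H}{d_W}=\frac{\log 9}{\log 5}$. $L^2(K)=L^2(K,\mu)$ with inner product $\langle\cdot,\cdot\rangle$. Dirichlet Laplacian: with $V_n=\bigcup_{|w|=n}F_w(V_0)$ and $x\sim y$ meaning that $x\neq y$ lie in a common $F_w(V_0)$ with $|w|=n$, let $\mathcal{E}(u,v)=\lim_{n\to\infty}(5/3)^n\sum_{x,y\in V_n,\,x\sim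 y}(u(x)-u(y))(v(x)-v(y))$ on $\mathcal{F}=\{u\in C(K):\mathcal{E}(u,u)<\infty,\ u|_{V_0}=0\}$. Its generator $\Delta$ on $L^2(K)$ is the Dirichlet Laplacian, with heat kernel $p_t(x,y)$. $-\Delta$ has eigenvalues $0<\lambda_1\le\lambda_2\le\cdots$ (with multiplicity) and an $L^2(K)$-orthonormal basis of eigenfunctions $\varphi_k$. Riesz kernel: $k_{s}(x,y)=\frac1{\Gamma(s/2)}\int_0^\infty t^{s/2-1}p_t(x,y)\,dt$ for $x\neq y$. Sobolev spaces: for $s>0$, $H^s(K)=(-\Delta)^{-s/2}[L^2(K)]$ with $\|v\|_{H^s}^2=\sum_k\lambda_k^s\langle v,\varphi_k\rangle^2$; $H^{-s}(K)$ is the completion of $L^2(K)$ with respect to $\|v\|_{H^{-s}}^2=\sum_k\lambda_k^{-s}\langle v,\varphi_k\rangle^2$, and $\langle\cdot,\cdot\rangle$ extends to the duality pairing $\langle\cdot,\cdot\rangle_{H^{-s},H^s}$. Test functions: $\mathcal{S}(K)=\{u\in C_0(K):\lim_{n\to\infty}n^k|\int_K\varphi_nu\,d\mu|=0\ \forall k\ge0\}$ ($C_0(K)$: continuous functions vanishing on $V_0$), with the topology induced by the norms $\|(-\Delta)^ku\|_{L^2}$, $k\ge0$; $\mathcal{S}'(K)$ is its dual. Definition (FGFF on $K$): a centered Gaussian random element $h:\Omega\to\mathcal{S}'(K)$ with $\mathbb{E}[\langle h,u\rangle\langle h,v\rangle]=\int_K\int_Kk_{d_S}(x,y)u(x)v(y)\,d\mu(x)\,d\mu(y)$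 for all $u,v\in\mathcal{S}(K)$. It exists, is unique in law, and lies $\mathbb{P}$-a.s. in $H^{-\varepsilon}(K)$ for every $\varepsilon>0$. Rescaled gasket: for $w\in\{1,2,3\}^n$, $K_w=F_w(K)$ carries the metric $d_w(x,y)=2^{-n}d(F_w^{-1}(x),F_w^{-1}(y))$, the measure $\mu_w$ with $(F_w^{-1})_\#\mu_w=3^{-n}\mu$, and the Dirichlet form on $L^2(K_w,\mu_w)$ given by $\mathcal{E}_w(u,v)=(5/3)^n\mathcal{E}(u\circ F_w,v\circ F_w)$ with domain $\mathcal{F}_w=\{u:u\circ F_w\in\mathcal{F}\}$ (so $u|_{F_w(V_0)}\equiv0$). Its heat kernel is $p^w_t$, its Riesz kernel is $k_s^w(x,y)=\frac1{\Gamma(s/2)}\int_0^\infty t^{s/2-1}p^w_t(x,y)\,dt$, and $H^{\pm\varepsilon}(K_w)$, $\mathcal{S}(K_w)$ are defined as for $K$, using the generator of $(\mathcal{E}_w,\mathcal{F}_w)$ on $L^2(K_w,\mu_w)$. The FGFF on $K_w$ is the centered Gaussian field whose covariance is $(u,v)\mapsto\int_{K_w}\int_{K_w}k^w_{d_S}(x,y)u(x)v(y)\,d\mu_w(x)\,d\mu_w(y)$. *)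

theory Defs
  imports "HOL-Probability.Probability"
begin

section \<open>The Sierpinski gasket\<close>

type_synonym plane = "real ^ 2"

text \<open>The vertices are \<open>p 1, p 2, p 3\<close>; other values of \<open>p\<close> are irrelevant.\<close>

definition unit_equilateral :: "(nat \<Rightarrow> plane) \<Rightarrow> bool" where
  "unit_equilateral p \<longleftrightarrow> (\<forall>i\<in>{1,2,3}. \<forall>j\<in>{1,2,3}. i \<noteq> j \<longrightarrow> dist (p i) (p j) = 1)"

definition contr :: "(nat \<Rightarrow> plane) \<Rightarrow> nat \<Rightarrow> plane \<Rightarrow> plane" where
  "contr p i x = (1/2) *\<^sub>R (x - p i) + p i"

definition words :: "nat \<Rightarrow> nat list set" where
  "words n = {w. length w = n \<and> set w \<subseteq> {1,2,3}}"

fun word_map :: "(nat \<Rightarrow> plane) \<Rightarrow> nat list \<Rightarrow> plane \<Rightarrow> plane" where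
  "word_map p [] = id"
| "word_map p (i # w) = contr p i \<circ> word_map p w"

text \<open>There is exactly one such set \<open>K\<close> (Hutchinson).\<close>

definition is_gasket :: "(nat \<Rightarrow> plane) \<Rightarrow> plane set \<Rightarrow> bool" where
  "is_gasket p K \<longleftrightarrow> K \<noteq> {} \<and> compact K \<and> K = (\<Union>i\<in>{1,2,3}. contr p i ` K)"

text \<open>There is exactly one such measure; it lives on the Borel sets of the subspace \<open>K\<close>, so
  values of functions outside \<open>K\<close> play no role in any integral.\<close>

definition is_self_similar_measure :: "(nat \<Rightarrow> plane) \<Rightarrow> plane set \<Rightarrow> plane measure \<Rightarrow> bool" where
  "is_self_similar_measure p K \<mu> \<longleftrightarrow>
     sets \<mu> = sets (restrict_space borel K) \<and> prob_space \<mu> \<and>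
     (\<forall>m. \<forall>w\<in>words m. measure \<mu> (word_map p w ` K) = (1/3) ^ m)"

definition V0 :: "(nat \<Rightarrow> plane) \<Rightarrow> plane set" where
  "V0 p = p ` {1,2,3}"

definition V :: "(nat \<Rightarrow> plane) \<Rightarrow> nat \<Rightarrow> plane set" where
  "V p n = (\<Union>w\<in>words n. word_map p w ` V0 p)"

definition adjacent :: "(nat \<Rightarrow> plane) \<Rightarrow> nat \<Rightarrow> plane \<Rightarrow> plane \<Rightarrow> bool" where
  "adjacent p n x y \<longleftrightarrow>
     x \<noteq> y \<and> (\<exists>w\<in>words n. x \<in> word_map p w ` V0 p \<and> y \<in> word_map p w ` V0 p)"

text \<open>The sum runs over ordered pairs, so every edge is counted twice.\<close>

definition graph_energy ::
    "(nat \<Rightarrow> plane) \<Rightarrow> nat \<Rightarrow> (plane \<Rightarrow> real) \<Rightarrow> (plane \<Rightarrow> real) \<Rightarrow> real" where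
  "graph_energy p n u v =
     (5/3) ^ n * (\<Sum>(x, y)\<in>{(x, y). x \<in> V p n \<and> y \<in> V p n \<and> adjacent p n x y}.
                    (u x - u y) * (v x - v y))"

definition gasket_energy ::
    "(nat \<Rightarrow> plane) \<Rightarrow> (plane \<Rightarrow> real) \<Rightarrow> (plane \<Rightarrow> real) \<Rightarrow> real" where
  "gasket_energy p u v = lim (\<lambda>n. graph_energy p n u v)"

text \<open>The sequence \<open>graph_energy p n u u\<close> is nondecreasing in \<open>n\<close>, so finiteness of its limit is
  convergence in the reals.\<close>

definition gasket_domain :: "(nat \<Rightarrow> plane) \<Rightarrow> plane set \<Rightarrow> (plane \<Rightarrow> real) set" where
  "gasket_domain p K =
     {u. continuous_on K u \<and> convergent (\<lambda>n. graph_energy p n u u) \<and> (\<forall>x\<in>V0 p. u x = 0)}"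

definition d_H :: real where "d_H = ln 3 / ln 2"
definition d_W :: real where "d_W = ln 5 / ln 2"
definition d_S :: real where "d_S = 2 * d_H / d_W"


section \<open>Spaces carrying a Dirichlet form\<close>

text \<open>Everything below is defined once for a set with boundary, measure and Dirichlet form, and
  then used both for the gasket and for its cells. Functions are total on the plane, and only their
  values on \<open>points\<close> matter. Elements of \<open>L\<^sup>2\<close> are represented by square integrable functions;
  elements of the form domain by their continuous versions.\<close>

record form_space =
  points :: "plane set"
  boundary :: "plane set"
  msr :: "plane measure"
  energy :: "(plane \<Rightarrow> real) \<Rightarrow> (plane \<Rightarrow> real) \<Rightarrow> real"
  form_domain :: "(plane \<Rightarrow> real) set"

definition gasket_space :: "(nat \<Rightarrow> plane) \<Rightarrow> plane set \<Rightarrow> plane measure \<Rightarrow> form_space" where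
  "gasket_space p K \<mu> =
     \<lparr> points = K, boundary = V0 p, msr = \<mu>,
       energy = gasket_energy p, form_domain = gasket_domain p K \<rparr>"

text \<open>The measure is the one whose image under the inverse of \<open>word_map p w\<close> is \<open>\<mu>\<close> scaled by
  \<open>3\<^sup>-\<^sup>n\<close> (see \<open>distr_cell_measure\<close> below).\<close>

definition cell_measure ::
    "(nat \<Rightarrow> plane) \<Rightarrow> plane set \<Rightarrow> plane measure \<Rightarrow> nat list \<Rightarrow> plane measure" where
  "cell_measure p K \<mu> w =
     scale_measure (ennreal ((1/3) ^ length w))
       (distr \<mu> (restrict_space borel (word_map p w ` K)) (word_map p w))"

text \<open>The metric of a cell is the restriction of the Euclidean one (see \<open>cell_dist\<close> below), hence
  needs no field of its own.\<close>

definition cell_space ::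
    "(nat \<Rightarrow> plane) \<Rightarrow> plane set \<Rightarrow> plane measure \<Rightarrow> nat list \<Rightarrow> form_space" where
  "cell_space p K \<mu> w =
     \<lparr> points = word_map p w ` K, boundary = word_map p w ` V0 p, msr = cell_measure p K \<mu> w,
       energy = (\<lambda>u v. (5/3) ^ length w * gasket_energy p (u \<circ> word_map p w) (v \<circ> word_map p w)),
       form_domain = {u. u \<circ> word_map p w \<in> gasket_domain p K} \<rparr>"

definition L2 :: "form_space \<Rightarrow> (plane \<Rightarrow> real) set" where
  "L2 X = {f. f \<in> borel_measurable (msr X) \<and> integrable (msr X) (\<lambda>x. (f x)\<^sup>2)}"

definition L2_inner :: "form_space \<Rightarrow> (plane \<Rightarrow> real) \<Rightarrow> (plane \<Rightarrow> real) \<Rightarrow> real" where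
  "L2_inner X f g = (\<integral>x. f x * g x \<partial>msr X)"

definition L2_norm :: "form_space \<Rightarrow> (plane \<Rightarrow> real) \<Rightarrow> real" where
  "L2_norm X f = sqrt (L2_inner X f f)"

text \<open>\<open>neg_laplacian X u f\<close>: \<open>u\<close> lies in the domain of the generator \<open>\<Delta>\<close> of the form and
  \<open>-\<Delta> u = f\<close>.\<close>

definition neg_laplacian :: "form_space \<Rightarrow> (plane \<Rightarrow> real) \<Rightarrow> (plane \<Rightarrow> real) \<Rightarrow> bool" where
  "neg_laplacian X u f \<longleftrightarrow>
     u \<in> form_domain X \<and> f \<in> L2 X \<and> (\<forall>v\<in>form_domain X. energy X u v = L2_inner X f v)"

text \<open>Eigenvalues (with multiplicity) in increasing order and an orthonormal basis of
  eigenfunctions. Index \<open>k\<close> stands for the usual index \<open>k + 1\<close>.\<close>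

definition eigenbasis :: "form_space \<Rightarrow> (nat \<Rightarrow> real) \<Rightarrow> (nat \<Rightarrow> plane \<Rightarrow> real) \<Rightarrow> bool" where
  "eigenbasis X lam \<phi> \<longleftrightarrow>
     (\<forall>k. 0 < lam k) \<and> mono lam \<and>
     (\<forall>k. neg_laplacian X (\<phi> k) (\<lambda>x. lam k * \<phi> k x)) \<and>
     (\<forall>j k. L2_inner X (\<phi> j) (\<phi> k) = (if j = k then 1 else 0)) \<and>
     (\<forall>f\<in>L2 X. (\<lambda>N. L2_norm X (\<lambda>x. f x - (\<Sum>k<N. L2_inner X f (\<phi> k) * \<phi> k x))) \<longlonglongrightarrow> 0)"

text \<open>The heat kernel is the jointly continuous integral kernel of the semigroup generated by
  \<open>\<Delta>\<close>: \<open>heat_flow X p f\<close> is the solution in \<open>L\<^sup>2\<close> of \<open>u' = \<Delta> u\<close> with initial value \<open>f\<close>.\<close>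

definition heat_flow ::
    "form_space \<Rightarrow> (real \<Rightarrow> plane \<Rightarrow> plane \<Rightarrow> real) \<Rightarrow> (plane \<Rightarrow> real) \<Rightarrow> real \<Rightarrow> plane \<Rightarrow> real" where
  "heat_flow X p f t x = (\<integral>y. p t x y * f y \<partial>msr X)"

definition heat_kernel :: "form_space \<Rightarrow> (real \<Rightarrow> plane \<Rightarrow> plane \<Rightarrow> real) \<Rightarrow> bool" where
  "heat_kernel X p \<longleftrightarrow>
     continuous_on ({0<..} \<times> points X \<times> points X) (\<lambda>(t, x, y). p t x y) \<and>
     (\<forall>f\<in>L2 X.
        (\<forall>t>0. \<exists>g. neg_laplacian X (heat_flow X p f t) g \<and>
           ((\<lambda>s. L2_norm X (\<lambda>x. (heat_flow X p f s x - heat_flow X p f t x) / (s - t) - (- g x)))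
              \<longlongrightarrow> 0) (at t)) \<and>
        ((\<lambda>t. L2_norm X (\<lambda>x. heat_flow X p f t x - f x)) \<longlongrightarrow> 0) (at_right 0))"

text \<open>Meaningful for \<open>x \<noteq> y\<close>; the diagonal is a null set for the product measure.\<close>

definition riesz_kernel ::
    "(real \<Rightarrow> plane \<Rightarrow> plane \<Rightarrow> real) \<Rightarrow> real \<Rightarrow> plane \<Rightarrow> plane \<Rightarrow> real" where
  "riesz_kernel p s x y = 1 / Gamma (s / 2) * (LBINT t:{0<..}. t powr (s / 2 - 1) * p t x y)"


section \<open>Test functions, distributions and Sobolev spaces\<close>

text \<open>The spaces in this section do not depend on the choice of the eigenbasis, so "some" could be
  replaced by "every" throughout.\<close>

definition test_functions :: "form_space \<Rightarrow> (plane \<Rightarrow> real) set" where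
  "test_functions X =
     {u. continuous_on (points X) u \<and> (\<forall>x\<in>boundary X. u x = 0) \<and>
         (\<exists>lam \<phi>. eigenbasis X lam \<phi> \<and>
            (\<forall>k. (\<lambda>n. real (Suc n) ^ k * \<bar>L2_inner X (\<phi> n) u\<bar>) \<longlonglongrightarrow> 0))}"

text \<open>The topology induced by the norms \<open>\<parallel>(-\<Delta>)\<^sup>k u\<parallel>\<close> in \<open>L\<^sup>2\<close>, \<open>k \<ge> 0\<close>. The relational power
  expresses \<open>(-\<Delta>)\<^sup>k (v - u) = f\<close>.\<close>

definition test_ball :: "form_space \<Rightarrow> nat \<Rightarrow> (plane \<Rightarrow> real) \<Rightarrow> real \<Rightarrow> (plane \<Rightarrow> real) set" where
  "test_ball X k u r =
     {v \<in> test_functions X. \<exists>f. (neg_laplacian X ^^ k) (\<lambda>x. v x - u x) f \<and> L2_norm X f < r}"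

definition test_topology :: "form_space \<Rightarrow> (plane \<Rightarrow> real) topology" where
  "test_topology X =
     topology_generated_by {test_ball X k u r | k u r. u \<in> test_functions X \<and> 0 < r}"

definition distributions :: "form_space \<Rightarrow> ((plane \<Rightarrow> real) \<Rightarrow> real) set" where
  "distributions X =
     {T. (\<forall>u\<in>test_functions X. \<forall>v\<in>test_functions X. T (\<lambda>x. u x + v x) = T u + T v) \<and>
         (\<forall>c. \<forall>u\<in>test_functions X. T (\<lambda>x. c * u x) = c * T u) \<and>
         continuous_map (test_topology X) euclideanreal T}"

text \<open>For \<open>s > 0\<close>, \<open>sobolev X s\<close> is the range of \<open>(-\<Delta>)\<^sup>-\<^sup>s\<^sup>/\<^sup>2\<close>, given by the functional calculus.\<close>

definition sobolev :: "form_space \<Rightarrow> real \<Rightarrow> (plane \<Rightarrow> real) set" where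
  "sobolev X s =
     {u \<in> L2 X. \<exists>lam \<phi>. eigenbasis X lam \<phi> \<and> (\<exists>f\<in>L2 X.
        (\<lambda>N. L2_norm X (\<lambda>x. u x - (\<Sum>k<N. lam k powr (- s / 2) * L2_inner X f (\<phi> k) * \<phi> k x)))
          \<longlonglongrightarrow> 0)}"

definition sobolev_norm ::
    "form_space \<Rightarrow> (nat \<Rightarrow> real) \<Rightarrow> (nat \<Rightarrow> plane \<Rightarrow> real) \<Rightarrow> real \<Rightarrow> (plane \<Rightarrow> real) \<Rightarrow> real" where
  "sobolev_norm X lam \<phi> s v = sqrt (\<Sum>k. lam k powr s * (L2_inner X v (\<phi> k))\<^sup>2)"

text \<open>The completion of \<open>L\<^sup>2\<close> in the norm of order \<open>-s\<close>, realised inside the distributions: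
  \<open>T\<close> belongs to it when \<open>T\<close> is represented by a Cauchy sequence in \<open>L\<^sup>2\<close>.\<close>

definition represents :: "form_space \<Rightarrow> real \<Rightarrow> (nat \<Rightarrow> plane \<Rightarrow> real) \<Rightarrow> ((plane \<Rightarrow> real) \<Rightarrow> real) \<Rightarrow> bool" where
  "represents X s v T \<longleftrightarrow>
     (\<forall>j. v j \<in> L2 X) \<and>
     (\<exists>lam \<phi>. eigenbasis X lam \<phi> \<and>
        (\<forall>e>0. \<exists>N. \<forall>i\<ge>N. \<forall>j\<ge>N. sobolev_norm X lam \<phi> (- s) (\<lambda>x. v i x - v j x) < e)) \<and>
     (\<forall>u\<in>test_functions X. (\<lambda>j. L2_inner X (v j) u) \<longlonglongrightarrow> T u)"

definition neg_sobolev :: "form_space \<Rightarrow> real \<Rightarrow> ((plane \<Rightarrow> real) \<Rightarrow> real) set" where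
  "neg_sobolev X s = {T \<in> distributions X. \<exists>v. represents X s v T}"

text \<open>The extension of the \<open>L\<^sup>2\<close> inner product to the pairing of order \<open>-s\<close> and \<open>s\<close>. For a
  distribution outside the Sobolev space of order \<open>-s\<close> (for the free field this is a null event)
  it is read as the pairing with test functions, so that it is defined for all distributions.\<close>

definition dual_pairing ::
    "form_space \<Rightarrow> real \<Rightarrow> ((plane \<Rightarrow> real) \<Rightarrow> real) \<Rightarrow> (plane \<Rightarrow> real) \<Rightarrow> real" where
  "dual_pairing X s T u =
     (if T \<in> neg_sobolev X s
      then (THE r. \<forall>v. represents X s v T \<longrightarrow> (\<lambda>j. L2_inner X (v j) u) \<longlonglongrightarrow> r)
      else T u)"


section \<open>The fractal Gaussian free field\<close>

definition centered_gaussian :: "'w measure \<Rightarrow> ('w \<Rightarrow> real) \<Rightarrow> bool" where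
  "centered_gaussian P Z \<longleftrightarrow> Z \<in> borel_measurable P \<and>
     ((AE \<omega> in P. Z \<omega> = 0) \<or>
      (\<exists>\<sigma>>0. distributed P lborel Z (\<lambda>z. ennreal (normal_density 0 \<sigma> z))))"

text \<open>Test functions form a vector space, so Gaussianity of every single pairing is joint
  Gaussianity; measurability of every pairing is measurability for the cylinder \<open>\<sigma>\<close>-algebra.\<close>

definition gaussian_random_distribution ::
    "form_space \<Rightarrow> 'w measure \<Rightarrow> ('w \<Rightarrow> (plane \<Rightarrow> real) \<Rightarrow> real) \<Rightarrow> bool" where
  "gaussian_random_distribution X P h \<longleftrightarrow>
     (\<forall>\<omega>\<in>space P. h \<omega> \<in> distributions X) \<and>
     (\<forall>u\<in>test_functions X. centered_gaussian P (\<lambda>\<omega>. h \<omega> u))"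

definition fgff :: "form_space \<Rightarrow> 'w measure \<Rightarrow> ('w \<Rightarrow> (plane \<Rightarrow> real) \<Rightarrow> real) \<Rightarrow> bool" where
  "fgff X P h \<longleftrightarrow>
     gaussian_random_distribution X P h \<and>
     (\<exists>p. heat_kernel X p \<and>
        (\<forall>u\<in>test_functions X. \<forall>v\<in>test_functions X.
           (\<integral>\<omega>. h \<omega> u * h \<omega> v \<partial>P) =
           (\<integral>x. (\<integral>y. riesz_kernel p d_S x y * u x * v y \<partial>msr X) \<partial>msr X)))"

text \<open>The field \<open>h \<circ> F\<^sub>w\<^sup>-\<^sup>1\<close> in the distributional sense.\<close>

definition pushed_field ::
    "(nat \<Rightarrow> plane) \<Rightarrow> plane set \<Rightarrow> plane measure \<Rightarrow> nat list \<Rightarrow> real \<Rightarrow>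
     ((plane \<Rightarrow> real) \<Rightarrow> real) \<Rightarrow> (plane \<Rightarrow> real) \<Rightarrow> real" where
  "pushed_field p K \<mu> w \<epsilon> T u =
     (1/3) ^ length w * dual_pairing (gasket_space p K \<mu>) \<epsilon> T (u \<circ> word_map p w)"


section \<open>Consistency of the cell data\<close>

lemma dist_word_map: "dist (word_map p w x) (word_map p w y) = (1/2) ^ length w * dist x y"
proof (induction w)
  case (Cons i w)
  have "dist (contr p i a) (contr p i b) = 1/2 * dist a b" for a b
    by (simp add: contr_def dist_norm flip: scaleR_diff_right)
  then show ?case using Cons by simp
qed simp

lemma inj_word_map: "inj (word_map p w)"
  by (rule injI) (metis dist_eq_0_iff dist_word_map mult_eq_0_iff power_not_zero
      zero_neq_one divide_eq_0_iff zero_neq_numeral)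

lemma cell_dist:
  assumes "x \<in> word_map p w ` K" "y \<in> word_map p w ` K"
  shows "dist x y = (1/2) ^ length w * dist (inv (word_map p w) x) (inv (word_map p w) y)"
  using assms by (auto simp: inj_word_map dist_word_map)

lemma continuous_on_word_map: "continuous_on A (word_map p w)"
proof (induction w arbitrary: A)
  case (Cons i w)
  have "continuous_on B (contr p i)" for B
    unfolding contr_def by (intro continuous_intros)
  then show ?case
    using Cons by (auto simp del: comp_apply intro!: continuous_on_compose)
qed (simp add: id_def)

lemma continuous_on_inv_word_map: "continuous_on (word_map p w ` A) (inv (word_map p w))"
proof -
  have "dist (inv (word_map p w) x) (inv (word_map p w) y) = 2 ^ length w * dist x y"
    if "x \<in> word_map p w ` A" "y \<in> word_map p w ` A" for x y
    using cell_dist[OF that] by (simp add: field_simps power_divide)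
  then have "(2 ^ length w)-lipschitz_on (word_map p w ` A) (inv (word_map p w))"
    by (intro lipschitz_onI) auto
  then show ?thesis by (rule lipschitz_on_continuous_on)
qed

lemma distr_cell_measure:
  assumes "is_self_similar_measure p K \<mu>"
  shows "distr (cell_measure p K \<mu> w) \<mu> (inv (word_map p w)) =
           scale_measure (ennreal ((1/3) ^ length w)) \<mu>"
proof -
  let ?F = "word_map p w" and ?N = "restrict_space borel (word_map p w ` K)"
  have s: "sets \<mu> = sets (restrict_space borel K)"
    using assms by (simp add: is_self_similar_measure_def)
  then have sp: "space \<mu> = K" by (auto dest: sets_eq_imp_space_eq simp: space_restrict_space)
  have F: "?F \<in> measurable \<mu> ?N"
    using borel_measurable_continuous_on_restrict[OF continuous_on_word_map[of K p w]] s sp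
    by (intro measurable_restrict_space2) (auto cong: measurable_cong_sets)
  have G: "inv ?F \<in> measurable ?N \<mu>"
  proof -
    have "inv ?F \<in> measurable ?N (restrict_space borel K)"
      using borel_measurable_continuous_on_restrict[OF continuous_on_inv_word_map[of p w K]]
      by (intro measurable_restrict_space2) (auto simp: space_restrict_space inj_word_map)
    then show ?thesis using s by (simp cong: measurable_cong_sets)
  qed
  show ?thesis
  proof (rule measure_eqI)
    fix A assume A: "A \<in> sets (distr (cell_measure p K \<mu> w) \<mu> (inv ?F))"
    then have A': "A \<in> sets \<mu>" "A \<subseteq> K" using sets.sets_into_space sp by auto
    have G': "inv ?F \<in> measurable (cell_measure p K \<mu> w) \<mu>"
      using G by (simp add: cell_measure_def cong: measurable_cong_sets)
    have sc: "space (cell_measure p K \<mu> w) = ?F ` K"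
      by (simp add: cell_measure_def space_scale_measure space_restrict_space)
    have B: "inv ?F -` A \<inter> ?F ` K \<in> sets ?N"
      using measurable_sets[OF G A'(1)] by (simp add: space_restrict_space)
    have "?F -` (inv ?F -` A \<inter> ?F ` K) \<inter> K = A"
      using A'(2) by (auto simp: inj_word_map inj_eq)
    then show "emeasure (distr (cell_measure p K \<mu> w) \<mu> (inv ?F)) A =
        emeasure (scale_measure (ennreal ((1/3) ^ length w)) \<mu>) A"
      using B F sp
      by (simp add: emeasure_distr[OF G' A'(1)] sc, simp add: cell_measure_def emeasure_distr)
  qed simp
qed

end

theory Submission
  imports Defs
begin

text \<open>Composition with \<open>F\<^sub>w\<close>, \<open>|w| = n\<close>, turns the cell into the gasket with the measure scaled by
  \<open>3\<^sup>-\<^sup>n\<close> and the energy by \<open>(5/3)\<^sup>n\<close>. Hence eigenvalues are multiplied by \<open>5\<^sup>n\<close>, the heat kernel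
  of the cell is \<open>3\<^sup>n p (5\<^sup>n t)\<close>, and the Riesz kernel of order \<open>s\<close> picks up the factor
  \<open>3\<^sup>n 5\<^sup>-\<^sup>n\<^sup>s\<^sup>/\<^sup>2\<close>, which is 1 exactly for \<open>s = d_S\<close>. The covariances then agree because \<open>h\<^sup>w\<close> carries
  the same factor \<open>3\<^sup>-\<^sup>n\<close> as the measure. What needs an argument beyond transport of structure is
  that the duality pairing does not depend on the representing sequence or on the eigenbases.\<close>

section \<open>Square integrable functions\<close>

text \<open>Gaussianity and covariance involve only values at test functions, where the pairing is
  plain evaluation. Independence matters once the pushed field is paired with a Sobolev function:
  \<open>dual_pairing\<close> is a definite description, and the basis that witnesses membership of
  \<open>u\<close> in the Sobolev space need not be the one in which a representing sequence is
  Cauchy. Transport is cheap because the change of variables laws hold for all functions: a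
  non-integrable function has integral 0 on both sides. So the covariances are compared without any
  estimate of the Riesz kernel. Finally, \<open>fgff\<close> asks for some heat kernel of the cell,
  and the rescaled kernel serves as the witness.\<close>

lemma L2_measurable: "f \<in> L2 X \<Longrightarrow> f \<in> borel_measurable (msr X)"
  by (simp add: L2_def)

lemma integrable_mult_L2:
  assumes "f \<in> L2 X" "g \<in> L2 X"
  shows "integrable (msr X) (\<lambda>x. f x * g x)"
proof (rule Bochner_Integration.integrable_bound)
  show "integrable (msr X) (\<lambda>x. (f x)\<^sup>2 + (g x)\<^sup>2)"
    using assms by (simp add: L2_def)
  show "(\<lambda>x. f x * g x) \<in> borel_measurable (msr X)"
    using assms by (intro borel_measurable_times L2_measurable)
  have "\<bar>a * b\<bar> \<le> a\<^sup>2 + b\<^sup>2" for a b :: real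
    using sum_squares_bound[of "\<bar>a\<bar>" "\<bar>b\<bar>"] mult_nonneg_nonneg[of "\<bar>a\<bar>" "\<bar>b\<bar>"]
    by (simp add: abs_mult del: mult_nonneg_nonneg)
  then show "AE x in msr X. norm (f x * g x) \<le> norm ((f x)\<^sup>2 + (g x)\<^sup>2)"
    by (auto intro!: always_eventually)
qed

lemma L2_add:
  assumes "f \<in> L2 X" "g \<in> L2 X"
  shows "(\<lambda>x. f x + g x) \<in> L2 X"
proof -
  have "integrable (msr X) (\<lambda>x. (f x)\<^sup>2 + (g x)\<^sup>2 + 2 * (f x * g x))"
    using integrable_mult_L2[OF assms] assms by (simp add: L2_def)
  then show ?thesis
    using assms by (auto simp: L2_def power2_sum mult.assoc intro!: borel_measurable_add)
qed

lemma L2_cmult: "f \<in> L2 X \<Longrightarrow> (\<lambda>x. c * f x) \<in> L2 X"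
  by (auto simp: L2_def power_mult_distrib intro!: borel_measurable_times)

lemma L2_cmult_iff: "c \<noteq> 0 \<Longrightarrow> (\<lambda>x. c * f x) \<in> L2 X \<longleftrightarrow> f \<in> L2 X"
  using L2_cmult[of f X c] L2_cmult[of "\<lambda>x. c * f x" X "1 / c"] by auto

lemma L2_diff:
  assumes "f \<in> L2 X" "g \<in> L2 X"
  shows "(\<lambda>x. f x - g x) \<in> L2 X"
  using L2_add[OF assms(1) L2_cmult[OF assms(2), of "-1"]] by simp

lemma L2_sum:
  assumes "\<And>i. i \<in> I \<Longrightarrow> f i \<in> L2 X"
  shows "(\<lambda>x. \<Sum>i\<in>I. f i x) \<in> L2 X"
proof -
  have "(\<lambda>x. 0) \<in> L2 X" by (simp add: L2_def)
  with assms show ?thesis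
    by (induction I rule: infinite_finite_induct) (auto intro!: L2_add)
qed

lemma L2_inner_commute: "L2_inner X f g = L2_inner X g f"
  by (simp add: L2_inner_def mult.commute)

lemma L2_inner_cmult_left: "L2_inner X (\<lambda>x. c * f x) g = c * L2_inner X f g"
  by (simp add: L2_inner_def mult.assoc)

lemma L2_inner_cmult_right: "L2_inner X f (\<lambda>x. c * g x) = c * L2_inner X f g"
  by (simp add: L2_inner_def mult.left_commute)

lemma L2_inner_add_left:
  "f \<in> L2 X \<Longrightarrow> g \<in> L2 X \<Longrightarrow> e \<in> L2 X \<Longrightarrow>
    L2_inner X (\<lambda>x. f x + g x) e = L2_inner X f e + L2_inner X g e"
  by (simp add: L2_inner_def distrib_right integrable_mult_L2)

lemma L2_inner_diff_left:
  "f \<in> L2 X \<Longrightarrow> g \<in> L2 X \<Longrightarrow> e \<in> L2 X \<Longrightarrow>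
    L2_inner X (\<lambda>x. f x - g x) e = L2_inner X f e - L2_inner X g e"
  by (simp add: L2_inner_def left_diff_distrib integrable_mult_L2)

lemma L2_inner_add_right:
  "f \<in> L2 X \<Longrightarrow> g \<in> L2 X \<Longrightarrow> e \<in> L2 X \<Longrightarrow>
    L2_inner X e (\<lambda>x. f x + g x) = L2_inner X e f + L2_inner X e g"
  using L2_inner_add_left[of f X g e] by (simp add: L2_inner_commute)

lemma L2_inner_diff_right:
  "f \<in> L2 X \<Longrightarrow> g \<in> L2 X \<Longrightarrow> e \<in> L2 X \<Longrightarrow>
    L2_inner X e (\<lambda>x. f x - g x) = L2_inner X e f - L2_inner X e g"
  using L2_inner_diff_left[of f X g e] by (simp add: L2_inner_commute)

lemma L2_inner_sum_left:
  "(\<And>i. i \<in> I \<Longrightarrow> f i \<in> L2 X) \<Longrightarrow> e \<in> L2 X \<Longrightarrow>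
    L2_inner X (\<lambda>x. \<Sum>i\<in>I. f i x) e = (\<Sum>i\<in>I. L2_inner X (f i) e)"
  by (simp add: L2_inner_def sum_distrib_right integrable_mult_L2)

lemma L2_inner_nonneg: "0 \<le> L2_inner X f f"
  by (simp add: L2_inner_def)

lemma L2_norm_nonneg: "0 \<le> L2_norm X f"
  by (simp add: L2_norm_def L2_inner_nonneg)

lemma L2_norm_cmult: "L2_norm X (\<lambda>x. c * f x) = \<bar>c\<bar> * L2_norm X f"
  by (simp add: L2_norm_def L2_inner_cmult_left L2_inner_cmult_right real_sqrt_mult
      flip: mult.assoc)

lemma L2_cauchy_schwarz:
  assumes f: "f \<in> L2 X" and g: "g \<in> L2 X"
  shows "\<bar>L2_inner X f g\<bar> \<le> L2_norm X f * L2_norm X g"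
proof -
  let ?A = "L2_inner X f f" and ?B = "L2_inner X f g" and ?C = "L2_inner X g g"
  have q: "0 \<le> ?A + 2 * t * ?B + t\<^sup>2 * ?C" for t
  proof -
    have "L2_inner X (\<lambda>x. f x + t * g x) (\<lambda>x. f x + t * g x) = ?A + 2 * t * ?B + t\<^sup>2 * ?C"
      using f g by (simp add: L2_inner_add_left L2_inner_add_right L2_add L2_cmult
          L2_inner_cmult_left L2_inner_cmult_right L2_inner_commute[of X g f] power2_eq_square
          algebra_simps)
    then show ?thesis by (metis L2_inner_nonneg)
  qed
  \<comment> \<open>For \<open>?C > 0\<close> the minimum of the quadratic is at
    \<open>t = - ?B / ?C\<close>. For \<open>?C = 0\<close> it is affine, and at
    \<open>t = - (?A + 1) / ?B\<close> it would equal \<open>- ?A - 2\<close>, which is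
    negative.\<close>
  have "?B\<^sup>2 \<le> ?A * ?C"
  proof (cases "?C = 0")
    case True
    have "?B = 0"
    proof (rule ccontr)
      assume "?B \<noteq> 0"
      then show False
        using q[of "- (?A + 1) / ?B"] True L2_inner_nonneg[of X f] by simp
    qed
    with True show ?thesis by simp
  next
    case False
    then have "0 < ?C" using L2_inner_nonneg[of X g] by linarith
    then show ?thesis
      using q[of "- ?B / ?C"] by (simp add: field_simps power2_eq_square)
  qed
  then have "sqrt (?B\<^sup>2) \<le> sqrt (?A * ?C)" by (rule real_sqrt_le_mono)
  then show ?thesis by (simp add: L2_norm_def real_sqrt_mult)
qed

lemma L2_inner_tendsto:
  assumes "(\<lambda>N. L2_norm X (\<lambda>x. f x - s N x)) \<longlonglongrightarrow> 0"
    and f: "f \<in> L2 X" and s: "\<And>N. s N \<in> L2 X" and g: "g \<in> L2 X"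
  shows "(\<lambda>N. L2_inner X (s N) g) \<longlonglongrightarrow> L2_inner X f g"
proof -
  have "(\<lambda>N. L2_inner X f g - L2_inner X (s N) g) \<longlonglongrightarrow> 0"
  proof (rule Lim_null_comparison)
    show "\<forall>\<^sub>F N in sequentially. norm (L2_inner X f g - L2_inner X (s N) g) \<le>
        L2_norm X (\<lambda>x. f x - s N x) * L2_norm X g"
      using L2_cauchy_schwarz[OF L2_diff[OF f s] g] f s g
      by (simp add: L2_inner_diff_left)
    show "(\<lambda>N. L2_norm X (\<lambda>x. f x - s N x) * L2_norm X g) \<longlonglongrightarrow> 0"
      using tendsto_mult_left_zero[OF assms(1)] .
  qed
  from tendsto_diff[OF tendsto_const this, of "L2_inner X f g"] show ?thesis by simp
qed


section \<open>Eigenbases and the duality pairing\<close>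

lemma eigenbasis_in_L2:
  assumes "eigenbasis X lam \<phi>"
  shows "\<phi> k \<in> L2 X"
proof -
  have "(\<lambda>x. lam k * \<phi> k x) \<in> L2 X" "lam k \<noteq> 0"
    using assms by (auto simp: eigenbasis_def neg_laplacian_def less_imp_neq[symmetric])
  then show ?thesis by (simp add: L2_cmult_iff)
qed

lemma parseval:
  assumes b: "eigenbasis X lam \<phi>" and f: "f \<in> L2 X" and g: "g \<in> L2 X"
  shows "(\<lambda>k. L2_inner X f (\<phi> k) * L2_inner X g (\<phi> k)) sums L2_inner X f g"
proof -
  note \<phi> = eigenbasis_in_L2[OF b]
  have "(\<lambda>N. L2_inner X (\<lambda>x. \<Sum>k<N. L2_inner X f (\<phi> k) * \<phi> k x) g) \<longlonglongrightarrow> L2_inner X f g"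
    using b f g \<phi>
    by (intro L2_inner_tendsto L2_sum L2_cmult) (auto simp: eigenbasis_def)
  then show ?thesis
    using g \<phi> by (simp add: sums_def L2_inner_sum_left L2_cmult L2_inner_cmult_left
        L2_inner_commute[of X "\<phi> _" g])
qed

lemma parseval_square:
  assumes "eigenbasis X lam \<phi>" "f \<in> L2 X"
  shows "(\<lambda>k. (L2_inner X f (\<phi> k))\<^sup>2) sums L2_inner X f f"
  using parseval[OF assms assms(2)] by (simp add: power2_eq_square)

text \<open>The weights \<open>lam k powr (- s)\<close> are bounded by their value at the lowest
  eigenvalue, and the rest is Parseval. Only with this convergence does the \<open>suminf\<close> in
  \<open>sobolev_norm\<close> dominate its partial sums.\<close>

lemma summable_neg_sobolev_norm:
  assumes b: "eigenbasis X lam \<phi>" and d: "d \<in> L2 X" and s: "0 < s"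
  shows "summable (\<lambda>k. lam k powr (- s) * (L2_inner X d (\<phi> k))\<^sup>2)"
proof (rule summable_comparison_test')
  have pos: "0 < lam k" "lam 0 \<le> lam k" for k
    using b by (auto simp: eigenbasis_def mono_def)
  show "summable (\<lambda>k. lam 0 powr (- s) * (L2_inner X d (\<phi> k))\<^sup>2)"
    using parseval_square[OF b d] by (intro summable_mult) (rule sums_summable)
  show "norm (lam k powr (- s) * (L2_inner X d (\<phi> k))\<^sup>2) \<le>
      lam 0 powr (- s) * (L2_inner X d (\<phi> k))\<^sup>2" for k
    using pos s by (auto intro!: mult_right_mono powr_mono2')
qed

text \<open>Homogeneity of the energy is required only in the form of moving a scalar from one argument to
  the other: \<open>gasket_energy\<close> is a \<open>lim\<close>, which does not commute with scalars unless it converges.\<close>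

locale symmetric_form =
  fixes X :: form_space
  assumes energy_commute: "energy X u v = energy X v u"
    and form_domain_continuous: "u \<in> form_domain X \<Longrightarrow> continuous_on (points X) u"
    and form_domain_boundary: "u \<in> form_domain X \<Longrightarrow> x \<in> boundary X \<Longrightarrow> u x = 0"
    and continuous_in_L2: "continuous_on (points X) u \<Longrightarrow> u \<in> L2 X"
    and energy_cmult: "energy X (\<lambda>x. c * u x) v = energy X u (\<lambda>x. c * v x)"
    and form_domain_cmult: "u \<in> form_domain X \<Longrightarrow> (\<lambda>x. c * u x) \<in> form_domain X"
begin

lemma test_functions_in_L2: "u \<in> test_functions X \<Longrightarrow> u \<in> L2 X"
  by (simp add: test_functions_def continuous_in_L2)

text \<open>By orthonormality the coefficients vanish beyond index \<open>j\<close>. Consequently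
  \<open>T (\<phi> j)\<close> is the limit along every sequence that represents \<open>T\<close>,
  which ties different representing sequences together.\<close>

lemma eigenfunction_test_function:
  assumes "eigenbasis X lam \<phi>"
  shows "\<phi> j \<in> test_functions X"
proof -
  have d: "\<phi> j \<in> form_domain X"
    using assms by (simp add: eigenbasis_def neg_laplacian_def)
  have "(\<lambda>n. real (Suc n) ^ k * \<bar>L2_inner X (\<phi> n) (\<phi> j)\<bar>) \<longlonglongrightarrow> 0" for k
  proof (rule tendsto_eventually)
    show "\<forall>\<^sub>F n in sequentially. real (Suc n) ^ k * \<bar>L2_inner X (\<phi> n) (\<phi> j)\<bar> = 0"
      using eventually_gt_at_top[of j] by eventually_elim (use assms in \<open>simp add: eigenbasis_def\<close>)
  qed
  with assms d show ?thesis
    unfolding test_functions_def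
    using form_domain_continuous form_domain_boundary by blast
qed

text \<open>Eigenfunctions of different eigenbases to different eigenvalues are orthogonal, so
  functions of the eigenvalue may be moved from one basis to the other.\<close>

lemma eigenvalue_swap:
  assumes "eigenbasis X lam \<phi>" "eigenbasis X lam' \<psi>"
  shows "g (lam j) * L2_inner X (\<phi> j) (\<psi> k) = g (lam' k) * L2_inner X (\<phi> j) (\<psi> k)"
proof -
  have "neg_laplacian X (\<phi> j) (\<lambda>x. lam j * \<phi> j x)" "neg_laplacian X (\<psi> k) (\<lambda>x. lam' k * \<psi> k x)"
    using assms by (auto simp: eigenbasis_def)
  then have "lam j * L2_inner X (\<phi> j) (\<psi> k) = lam' k * L2_inner X (\<psi> k) (\<phi> j)"
    using energy_commute[of "\<phi> j" "\<psi> k"]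
    by (auto simp: neg_laplacian_def L2_inner_cmult_left)
  then show ?thesis by (auto simp: L2_inner_commute[of X "\<psi> k"])
qed

text \<open>Encodes u = (-\<Delta>)^(-s/2) f through the coefficients in all eigenbases at once,
  while \<open>sobolev\<close> supplies a single basis. The estimates below are made in whichever
  basis the representing sequence is Cauchy.\<close>

definition potential :: "real \<Rightarrow> (plane \<Rightarrow> real) \<Rightarrow> (plane \<Rightarrow> real) \<Rightarrow> bool" where
  "potential s u f \<longleftrightarrow> u \<in> L2 X \<and> f \<in> L2 X \<and>
     (\<forall>lam \<phi> j. eigenbasis X lam \<phi> \<longrightarrow>
        L2_inner X u (\<phi> j) = lam j powr (- s / 2) * L2_inner X f (\<phi> j))"

text \<open>Pair the expansion of \<open>u\<close> in the given basis with an eigenfunction of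
  another one: \<open>eigenvalue_swap\<close> turns each power of \<open>lam k\<close> into the
  power of \<open>lam' j\<close>, and Parseval sums what remains. The same \<open>f\<close> serves
  all bases.\<close>

lemma sobolev_potential:
  assumes "u \<in> sobolev X s"
  shows "\<exists>f. potential s u f"
proof -
  obtain lam \<phi> f where b: "eigenbasis X lam \<phi>" and f: "f \<in> L2 X" and u: "u \<in> L2 X"
    and lim: "(\<lambda>N. L2_norm X (\<lambda>x. u x - (\<Sum>k<N. lam k powr (- s / 2) * L2_inner X f (\<phi> k) * \<phi> k x)))
          \<longlonglongrightarrow> 0"
    using assms by (auto simp: sobolev_def)
  note \<phi> = eigenbasis_in_L2[OF b]
  have "L2_inner X u (\<psi> j) = lam' j powr (- s / 2) * L2_inner X f (\<psi> j)"
    if b': "eigenbasis X lam' \<psi>" for lam' \<psi> j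
  proof -
    note \<psi> = eigenbasis_in_L2[OF b']
    have "(\<lambda>N. L2_inner X (\<lambda>x. \<Sum>k<N. lam k powr (- s / 2) * L2_inner X f (\<phi> k) * \<phi> k x) (\<psi> j))
        \<longlonglongrightarrow> L2_inner X u (\<psi> j)"
      using u \<phi> \<psi> by (intro L2_inner_tendsto lim L2_sum L2_cmult) auto
    moreover have "L2_inner X (\<lambda>x. \<Sum>k<N. lam k powr (- s / 2) * L2_inner X f (\<phi> k) * \<phi> k x) (\<psi> j) =
        lam' j powr (- s / 2) * (\<Sum>k<N. L2_inner X f (\<phi> k) * L2_inner X (\<psi> j) (\<phi> k))" for N
    proof -
      have "lam k powr (- s / 2) * L2_inner X f (\<phi> k) * L2_inner X (\<phi> k) (\<psi> j) =
          lam' j powr (- s / 2) * (L2_inner X f (\<phi> k) * L2_inner X (\<psi> j) (\<phi> k))" for k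
        using eigenvalue_swap[OF b b', of "\<lambda>l. l powr (- s / 2)" k j]
        by (auto simp: L2_inner_commute[of X "\<psi> j"])
      note * = this
      have "L2_inner X (\<lambda>x. \<Sum>k<N. lam k powr (- s / 2) * L2_inner X f (\<phi> k) * \<phi> k x) (\<psi> j) =
          (\<Sum>k<N. lam k powr (- s / 2) * L2_inner X f (\<phi> k) * L2_inner X (\<phi> k) (\<psi> j))"
        using \<phi> \<psi> by (simp add: L2_inner_sum_left L2_cmult L2_inner_cmult_left)
      also have "\<dots> = lam' j powr (- s / 2) * (\<Sum>k<N. L2_inner X f (\<phi> k) * L2_inner X (\<psi> j) (\<phi> k))"
        unfolding * sum_distrib_left ..
      finally show ?thesis .
    qed
    ultimately have "(\<lambda>N. lam' j powr (- s / 2) *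
        (\<Sum>k<N. L2_inner X f (\<phi> k) * L2_inner X (\<psi> j) (\<phi> k))) \<longlonglongrightarrow> L2_inner X u (\<psi> j)"
      by simp
    moreover have "(\<lambda>N. lam' j powr (- s / 2) *
        (\<Sum>k<N. L2_inner X f (\<phi> k) * L2_inner X (\<psi> j) (\<phi> k))) \<longlonglongrightarrow>
        lam' j powr (- s / 2) * L2_inner X f (\<psi> j)"
      using parseval[OF b f \<psi>] unfolding sums_def by (rule tendsto_mult_left)
    ultimately show ?thesis by (rule LIMSEQ_unique)
  qed
  with u f show ?thesis by (auto simp: potential_def)
qed

text \<open>Spectral truncation commutes with (-\<Delta>)^(-s/2). The remainder of \<open>u\<close>
  is thus controlled by the remainder of \<open>f\<close>, which tends to 0 in
  \<open>L2_norm\<close>.\<close>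

lemma potential_remainder:
  assumes p: "potential s u f" and b: "eigenbasis X lam \<phi>"
  shows "potential s (\<lambda>x. u x - (\<Sum>k<N. L2_inner X u (\<phi> k) * \<phi> k x))
           (\<lambda>x. f x - (\<Sum>k<N. L2_inner X f (\<phi> k) * \<phi> k x))"
proof -
  note \<phi> = eigenbasis_in_L2[OF b]
  have uf: "u \<in> L2 X" "f \<in> L2 X" using p by (auto simp: potential_def)
  have "L2_inner X (\<lambda>x. u x - (\<Sum>k<N. L2_inner X u (\<phi> k) * \<phi> k x)) (\<psi> j) =
      lam' j powr (- s / 2) * L2_inner X (\<lambda>x. f x - (\<Sum>k<N. L2_inner X f (\<phi> k) * \<phi> k x)) (\<psi> j)"
    if b': "eigenbasis X lam' \<psi>" for lam' \<psi> j
  proof -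
    note \<psi> = eigenbasis_in_L2[OF b']
    have "(\<Sum>k<N. L2_inner X u (\<phi> k) * L2_inner X (\<phi> k) (\<psi> j)) =
        (\<Sum>k<N. lam' j powr (- s / 2) * (L2_inner X f (\<phi> k) * L2_inner X (\<phi> k) (\<psi> j)))"
    proof (rule sum.cong)
      show "L2_inner X u (\<phi> k) * L2_inner X (\<phi> k) (\<psi> j) =
          lam' j powr (- s / 2) * (L2_inner X f (\<phi> k) * L2_inner X (\<phi> k) (\<psi> j))" for k
        using p b eigenvalue_swap[OF b b', of "\<lambda>l. l powr (- s / 2)" k j]
        by (auto simp: potential_def)
    qed simp
    moreover have "L2_inner X u (\<psi> j) = lam' j powr (- s / 2) * L2_inner X f (\<psi> j)"
      using p b' by (simp add: potential_def)
    ultimately show ?thesis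
      using uf \<phi> \<psi> by (simp add: L2_inner_diff_left L2_inner_sum_left L2_sum L2_cmult
          L2_inner_cmult_left right_diff_distrib sum_distrib_left)
  qed
  with uf \<phi> show ?thesis by (auto simp: potential_def intro!: L2_diff L2_sum L2_cmult)
qed

text \<open>The factor lam^(-s/2) in the coefficients of \<open>u\<close> is moved to those of
  \<open>d\<close>; then Cauchy-Schwarz for finite sums applies to \<open>D\<close> and
  \<open>G\<close>, and Parseval supplies the limit of the partial sums.\<close>

lemma potential_pairing_bound:
  assumes p: "potential s u f" and b: "eigenbasis X lam \<phi>" and d: "d \<in> L2 X" and s: "0 < s"
  shows "\<bar>L2_inner X d u\<bar> \<le> sobolev_norm X lam \<phi> (- s) d * L2_norm X f"
proof -
  have u: "u \<in> L2 X" and f: "f \<in> L2 X"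
    and uf: "\<And>j. L2_inner X u (\<phi> j) = lam j powr (- s / 2) * L2_inner X f (\<phi> j)"
    using p b by (auto simp: potential_def)
  define D where "D k = lam k powr (- s / 2) * L2_inner X d (\<phi> k)" for k
  define G where "G k = L2_inner X f (\<phi> k)" for k
  have D2: "(D k)\<^sup>2 = lam k powr (- s) * (L2_inner X d (\<phi> k))\<^sup>2" for k
    by (simp add: D_def power_mult_distrib power2_eq_square[of "_ powr _"] flip: powr_add)
  have summable_D: "summable (\<lambda>k. (D k)\<^sup>2)"
    using summable_neg_sobolev_norm[OF b d s] by (simp only: D2)
  have "\<bar>\<Sum>k<N. L2_inner X d (\<phi> k) * L2_inner X u (\<phi> k)\<bar> \<le>
      sobolev_norm X lam \<phi> (- s) d * L2_norm X f" for N
  proof -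
    have "\<bar>\<Sum>k<N. L2_inner X d (\<phi> k) * L2_inner X u (\<phi> k)\<bar> = \<bar>\<Sum>k<N. D k * G k\<bar>"
      by (simp add: D_def G_def uf ac_simps)
    also have "\<dots> \<le> (\<Sum>k<N. \<bar>D k\<bar> * \<bar>G k\<bar>)"
      by (rule order_trans[OF sum_abs]) (simp add: abs_mult)
    also have "\<dots> \<le> L2_set D {..<N} * L2_set G {..<N}"
      by (rule L2_set_mult_ineq)
    also have "\<dots> \<le> sobolev_norm X lam \<phi> (- s) d * L2_norm X f"
    proof (rule mult_mono)
      show "L2_set D {..<N} \<le> sobolev_norm X lam \<phi> (- s) d"
        unfolding L2_set_def sobolev_norm_def D2[symmetric]
        by (intro real_sqrt_le_mono sum_le_suminf summable_D) auto
      show "L2_set G {..<N} \<le> L2_norm X f"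
        unfolding L2_set_def L2_norm_def G_def sums_unique[OF parseval_square[OF b f]]
        by (intro real_sqrt_le_mono sum_le_suminf sums_summable[OF parseval_square[OF b f]]) auto
      show "0 \<le> sobolev_norm X lam \<phi> (- s) d"
        unfolding sobolev_norm_def D2[symmetric]
        by (intro real_sqrt_ge_zero suminf_nonneg summable_D) auto
    qed (simp add: L2_set_nonneg)
    finally show ?thesis .
  qed
  moreover have "(\<lambda>N. \<bar>\<Sum>k<N. L2_inner X d (\<phi> k) * L2_inner X u (\<phi> k)\<bar>) \<longlonglongrightarrow> \<bar>L2_inner X d u\<bar>"
    using parseval[OF b d u] unfolding sums_def by (rule tendsto_rabs)
  ultimately show ?thesis by (meson LIMSEQ_le_const2)
qed

text \<open>The limit along any representing sequence is the limit of \<open>T\<close> on the eigenfunction expansion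
  of \<open>u\<close>, since pairing with the remainder is bounded uniformly along the sequence.\<close>

lemma pairing_well_defined:
  assumes u: "u \<in> sobolev X s" and s: "0 < s"
  shows "\<exists>l. \<forall>v. represents X s v T \<longrightarrow> (\<lambda>j. L2_inner X (v j) u) \<longlonglongrightarrow> l"
proof -
  obtain f where p: "potential s u f" using sobolev_potential[OF u] by blast
  obtain lam \<phi> where b: "eigenbasis X lam \<phi>" using u by (auto simp: sobolev_def)
  note \<phi> = eigenbasis_in_L2[OF b]
  have L2: "u \<in> L2 X" "f \<in> L2 X" using p by (auto simp: potential_def)
  define S where "S g N x = (\<Sum>k<N. L2_inner X g (\<phi> k) * \<phi> k x)" for g N x
  have S_L2: "S g N \<in> L2 X" for g N
    unfolding S_def[abs_def] by (intro L2_sum L2_cmult \<phi>)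
  have rem: "potential s (\<lambda>x. u x - S u N x) (\<lambda>x. f x - S f N x)" for N
    using potential_remainder[OF p b] by (simp add: S_def)
  have S_lim: "(\<lambda>N. L2_norm X (\<lambda>x. g x - S g N x)) \<longlonglongrightarrow> 0" if "g \<in> L2 X" for g
    using b that by (simp add: eigenbasis_def S_def)
  \<comment> \<open>\<open>l\<close> is fixed before the representing sequence \<open>v\<close>, so
    its limit is the same for all of them.\<close>
  define l where "l N = (\<Sum>k<N. L2_inner X u (\<phi> k) * T (\<phi> k))" for N
  have "(\<lambda>j. L2_inner X (v j) u) \<longlonglongrightarrow> lim l" if rep: "represents X s v T" for v
  proof -
    have v: "v j \<in> L2 X" for j using rep by (simp add: represents_def)
    obtain lam' \<psi> where b': "eigenbasis X lam' \<psi>" and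
      cauchy: "\<And>e. 0 < e \<Longrightarrow> \<exists>N. \<forall>i\<ge>N. \<forall>j\<ge>N. sobolev_norm X lam' \<psi> (- s) (\<lambda>x. v i x - v j x) < e"
      using rep by (auto simp: represents_def)
    have bound: "\<bar>L2_inner X (v i) u' - L2_inner X (v j) u'\<bar> \<le>
        sobolev_norm X lam' \<psi> (- s) (\<lambda>x. v i x - v j x) * L2_norm X f'"
      if "potential s u' f'" for u' f' i j
      using potential_pairing_bound[OF that b' L2_diff[OF v v] s, of i j] that v
      by (simp add: L2_inner_diff_left potential_def)
    have "Cauchy (\<lambda>j. L2_inner X (v j) u)"
    proof (rule metric_CauchyI)
      fix e :: real assume "0 < e"
      \<comment> \<open>The added 1 avoids division by 0 when the norm of \<open>f\<close>
        vanishes.\<close>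
      define e' where "e' = e / (L2_norm X f + 1)"
      have n: "0 < L2_norm X f + 1" using L2_norm_nonneg[of X f] by linarith
      then have "0 < e'" using \<open>0 < e\<close> by (simp add: e'_def)
      from cauchy[OF this] obtain N where
        N: "\<And>i j. i \<ge> N \<Longrightarrow> j \<ge> N \<Longrightarrow> sobolev_norm X lam' \<psi> (- s) (\<lambda>x. v i x - v j x) < e'"
        by blast
      have "dist (L2_inner X (v i) u) (L2_inner X (v j) u) < e" if "i \<ge> N" "j \<ge> N" for i j
      proof -
        have "dist (L2_inner X (v i) u) (L2_inner X (v j) u) \<le> e' * L2_norm X f"
          using bound[OF p, of i j] mult_right_mono[OF less_imp_le[OF N[OF that]] L2_norm_nonneg]
          unfolding dist_real_def by (rule order_trans)
        also have "\<dots> < e' * (L2_norm X f + 1)" using \<open>0 < e'\<close> by simp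
        also have "\<dots> = e" using n by (simp add: e'_def)
        finally show ?thesis .
      qed
      then show "\<exists>M. \<forall>m\<ge>M. \<forall>n\<ge>M. dist (L2_inner X (v m) u) (L2_inner X (v n) u) < e" by blast
    qed
    then obtain a where a: "(\<lambda>j. L2_inner X (v j) u) \<longlonglongrightarrow> a"
      by (auto simp: Cauchy_convergent_iff convergent_def)
    obtain M where
      M: "\<And>j. j \<ge> M \<Longrightarrow> sobolev_norm X lam' \<psi> (- s) (\<lambda>x. v j x - v M x) < 1"
      using cauchy[of 1] by force
    have l: "(\<lambda>j. L2_inner X (v j) (S u N)) \<longlonglongrightarrow> l N" for N
    proof -
      have "L2_inner X (v j) (S u N) = (\<Sum>k<N. L2_inner X u (\<phi> k) * L2_inner X (v j) (\<phi> k))" for j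
        using v \<phi> by (simp add: S_def[abs_def] L2_inner_commute[of X "v j"] L2_inner_sum_left
            L2_cmult L2_inner_cmult_left)
      moreover have "(\<lambda>j. L2_inner X (v j) (\<phi> k)) \<longlonglongrightarrow> T (\<phi> k)" for k
        using rep eigenfunction_test_function[OF b] by (simp add: represents_def)
      ultimately show ?thesis by (auto simp: l_def intro!: tendsto_intros)
    qed
    \<comment> \<open>First term: Cauchy-Schwarz in \<open>L2\<close> for the fixed
      \<open>v M\<close>. Second term: the dual bound for \<open>v j - v M\<close>, whose negative
      norm is below 1 once \<open>j \<ge> M\<close>. Neither depends on \<open>j\<close>, and both
      tend to 0 in \<open>N\<close>.\<close>
    define B where "B N = L2_norm X (v M) * L2_norm X (\<lambda>x. u x - S u N x) +
        L2_norm X (\<lambda>x. f x - S f N x)" for N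
    have "\<bar>a - l N\<bar> \<le> B N" for N
    proof -
      have "\<bar>L2_inner X (v j) u - L2_inner X (v j) (S u N)\<bar> \<le> B N" if "j \<ge> M" for j
      proof -
        let ?r = "\<lambda>x. u x - S u N x"
        have "\<bar>L2_inner X (v M) ?r\<bar> \<le> L2_norm X (v M) * L2_norm X ?r"
          using v L2 S_L2 by (intro L2_cauchy_schwarz L2_diff)
        moreover have "\<bar>L2_inner X (v j) ?r - L2_inner X (v M) ?r\<bar> \<le>
            1 * L2_norm X (\<lambda>x. f x - S f N x)"
          using bound[OF rem] mult_right_mono[OF less_imp_le[OF M[OF that]] L2_norm_nonneg]
          by (rule order_trans)
        ultimately show ?thesis
          using v L2 S_L2 by (simp add: B_def L2_inner_diff_right)
      qed
      moreover have "(\<lambda>j. \<bar>L2_inner X (v j) u - L2_inner X (v j) (S u N)\<bar>) \<longlonglongrightarrow> \<bar>a - l N\<bar>"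
        by (intro tendsto_intros a l)
      ultimately show ?thesis by (meson LIMSEQ_le_const2)
    qed
    moreover have "B \<longlonglongrightarrow> 0"
      using tendsto_add[OF tendsto_mult_right_zero[OF S_lim[OF L2(1)]] S_lim[OF L2(2)]]
      by (simp add: B_def[abs_def])
    ultimately have "(\<lambda>N. a - l N) \<longlonglongrightarrow> 0"
      by (intro Lim_null_comparison[of "\<lambda>N. a - l N" B]) auto
    from tendsto_diff[OF tendsto_const this, of a] have "l \<longlonglongrightarrow> a" by simp
    with a show ?thesis by (simp add: limI)
  qed
  then show ?thesis by blast
qed

end

text \<open>Existence of a representing sequence is what makes the definite description unique: with
  none, every \<open>r\<close> would satisfy its condition vacuously.\<close>

lemma dual_pairing_eqI:
  assumes "T \<in> neg_sobolev X s"
    and l: "\<And>v. represents X s v T \<Longrightarrow> (\<lambda>j. L2_inner X (v j) u) \<longlonglongrightarrow> l"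
  shows "dual_pairing X s T u = l"
proof -
  obtain v where v: "represents X s v T" using assms(1) by (auto simp: neg_sobolev_def)
  have "(THE r. \<forall>v. represents X s v T \<longrightarrow> (\<lambda>j. L2_inner X (v j) u) \<longlonglongrightarrow> r) = l"
    using v l by (blast intro: the_equality LIMSEQ_unique)
  then show ?thesis using assms(1) by (simp add: dual_pairing_def)
qed

text \<open>The last clause of \<open>represents\<close> already prescribes the limit on test
  functions, and the other branch of \<open>dual_pairing\<close> has the same value.\<close>

lemma dual_pairing_test_function:
  assumes "u \<in> test_functions X"
  shows "dual_pairing X s T u = T u"
proof (cases "T \<in> neg_sobolev X s")
  case True
  then show ?thesis
    by (rule dual_pairing_eqI) (use assms in \<open>simp add: represents_def\<close>)
qed (simp add: dual_pairing_def)

context symmetric_form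
begin

lemma neg_laplacian_cmult:
  assumes "neg_laplacian X u f"
  shows "neg_laplacian X (\<lambda>x. c * u x) (\<lambda>x. c * f x)"
  using assms form_domain_cmult[of _ c]
  by (simp add: neg_laplacian_def energy_cmult L2_cmult L2_inner_cmult_left L2_inner_cmult_right)

lemma neg_laplacian_cmult_iff:
  assumes "c \<noteq> 0"
  shows "neg_laplacian X (\<lambda>x. c * u x) (\<lambda>x. c * f x) \<longleftrightarrow> neg_laplacian X u f"
  using neg_laplacian_cmult[of "\<lambda>x. c * u x" "\<lambda>x. c * f x" "1 / c"] neg_laplacian_cmult[of u f c]
    assms by auto

text \<open>The value at a sum is not read off \<open>dual_pairing_test_function\<close>, since two
  test functions may be certified by different eigenbases; it is computed as a limit along
  representing sequences instead.\<close>

lemma dual_pairing_distribution: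
  assumes T: "T \<in> distributions X"
  shows "dual_pairing X s T \<in> distributions X"
proof -
  let ?D = "dual_pairing X s T"
  have add: "?D (\<lambda>x. u x + v x) = ?D u + ?D v"
    if uv: "u \<in> test_functions X" "v \<in> test_functions X" for u v
  proof (cases "T \<in> neg_sobolev X s")
    case True
    have "?D (\<lambda>x. u x + v x) = T u + T v"
    proof (rule dual_pairing_eqI[OF True])
      fix a assume a: "represents X s a T"
      then have "(\<lambda>j. L2_inner X (a j) u + L2_inner X (a j) v) \<longlonglongrightarrow> T u + T v"
        using uv by (intro tendsto_add) (auto simp: represents_def)
      then show "(\<lambda>j. L2_inner X (a j) (\<lambda>x. u x + v x)) \<longlonglongrightarrow> T u + T v"
        using a uv by (simp add: represents_def L2_inner_add_right test_functions_in_L2)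
    qed
    with uv show ?thesis by (simp add: dual_pairing_test_function)
  next
    case False
    with T uv show ?thesis by (simp add: dual_pairing_def distributions_def)
  qed
  have cmult: "?D (\<lambda>x. c * u x) = c * ?D u" if u: "u \<in> test_functions X" for c u
  proof (cases "T \<in> neg_sobolev X s")
    case True
    have "?D (\<lambda>x. c * u x) = c * T u"
    proof (rule dual_pairing_eqI[OF True])
      fix a assume "represents X s a T"
      then show "(\<lambda>j. L2_inner X (a j) (\<lambda>x. c * u x)) \<longlonglongrightarrow> c * T u"
        using u by (auto simp: represents_def L2_inner_cmult_right intro!: tendsto_intros)
    qed
    with u show ?thesis by (simp add: dual_pairing_test_function)
  next
    case False
    with T u show ?thesis by (simp add: dual_pairing_def distributions_def)
  qed
  \<comment> \<open>Continuity concerns only the carrier of the topology, where the pairing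
    coincides with \<open>T\<close>.\<close>
  have "topspace (test_topology X) \<subseteq> test_functions X"
    by (auto simp: test_topology_def test_ball_def)
  moreover have "continuous_map (test_topology X) euclideanreal T"
    using T by (simp add: distributions_def)
  ultimately have "continuous_map (test_topology X) euclideanreal ?D"
    by (rule_tac continuous_map_eq[of _ _ T]) (auto simp: dual_pairing_test_function)
  with add cmult show ?thesis by (simp add: distributions_def)
qed

end

section \<open>Similar form spaces\<close>

text \<open>Under \<open>F\<close> the measure is scaled by \<open>a\<close> and the energy by \<open>r * a\<close>, so the eigenvalues are
  scaled by \<open>r\<close>.\<close>

locale form_similarity = symmetric_form X for X +
  fixes Y :: form_space and F :: "plane \<Rightarrow> plane" and a r :: real
  assumes bij: "bij F" and a: "0 < a" and r: "0 < r"
    and points: "points Y = F ` points X"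
    and boundary: "boundary Y = F ` boundary X"
    and continuous_F: "continuous_on (points X) F"
    and continuous_inv: "continuous_on (points Y) (inv F)"
    and measurable_iff: "\<And>f :: plane \<Rightarrow> real.
      f \<in> borel_measurable (msr Y) \<longleftrightarrow> f \<circ> F \<in> borel_measurable (msr X)"
    and integrable_iff: "\<And>f :: plane \<Rightarrow> real.
      integrable (msr Y) f \<longleftrightarrow> integrable (msr X) (f \<circ> F)"
    and integral_eq: "\<And>f :: plane \<Rightarrow> real.
      (\<integral>x. f x \<partial>msr Y) = a * (\<integral>x. f (F x) \<partial>msr X)"
    and energy_eq: "energy Y u v = r * a * energy X (u \<circ> F) (v \<circ> F)"
    and form_domain_iff: "u \<in> form_domain Y \<longleftrightarrow> u \<circ> F \<in> form_domain X"
begin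

lemma inv_F [simp]: "inv F (F x) = x" "F (inv F x) = x"
  using bij by (auto simp: bij_def surj_f_inv_f)

lemma comp_inv_F [simp]: "f \<circ> inv F \<circ> F = f" "f \<circ> F \<circ> inv F = f"
  by (auto simp: fun_eq_iff)

lemma ex_surj_iff: "surj g \<Longrightarrow> (\<exists>y. P y) \<longleftrightarrow> (\<exists>x. P (g x))"
  by (metis surjE)

text \<open>\<open>F\<close> is a bijection of the whole plane, so every total function
  \<open>v\<close> has the form \<open>u \<circ> F\<close>, with
  \<open>u = v \<circ> inv F\<close>.\<close>

lemma ball_comp_F:
  fixes A B :: "(plane \<Rightarrow> real) set"
  assumes "\<And>u. u \<in> A \<longleftrightarrow> u \<circ> F \<in> B"
  shows "(\<forall>u\<in>A. P (u \<circ> F)) \<longleftrightarrow> (\<forall>v\<in>B. P v)"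
proof (intro iffI ballI)
  fix v assume *: "\<forall>u\<in>A. P (u \<circ> F)" and "v \<in> B"
  then have "v \<circ> inv F \<in> A" using assms by simp
  with * have "P (v \<circ> inv F \<circ> F)" by blast
  then show "P v" by simp
qed (use assms in blast)

lemma L2_iff: "f \<in> L2 Y \<longleftrightarrow> f \<circ> F \<in> L2 X"
  using measurable_iff[of f] integrable_iff[of "\<lambda>x. (f x)\<^sup>2"] by (simp add: L2_def o_def)

lemma inner_eq: "L2_inner Y f g = a * L2_inner X (f \<circ> F) (g \<circ> F)"
  by (simp add: L2_inner_def integral_eq)

lemma norm_eq: "L2_norm Y f = sqrt a * L2_norm X (f \<circ> F)"
  by (simp add: L2_norm_def inner_eq real_sqrt_mult)

text \<open>The energy carries the factor \<open>r * a\<close> and the inner product carries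
  \<open>a\<close>; after cancelling \<open>a\<close>, the factor \<open>1 / r\<close> stays with
  \<open>f\<close>.\<close>

lemma neg_laplacian_iff:
  "neg_laplacian Y u f \<longleftrightarrow> neg_laplacian X (u \<circ> F) (\<lambda>x. 1 / r * f (F x))"
proof -
  have "(\<forall>v\<in>form_domain Y. energy Y u v = L2_inner Y f v) \<longleftrightarrow>
      (\<forall>v\<in>form_domain X. energy Y u (v \<circ> inv F) = L2_inner Y f (v \<circ> inv F))"
    using ball_comp_F[OF form_domain_iff,
        of "\<lambda>v. energy Y u (v \<circ> inv F) = L2_inner Y f (v \<circ> inv F)"] by simp
  moreover have "energy Y u (v \<circ> inv F) = L2_inner Y f (v \<circ> inv F) \<longleftrightarrow>
      energy X (u \<circ> F) v = L2_inner X (\<lambda>x. 1 / r * f (F x)) v" for v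
    using a r unfolding L2_inner_cmult_left
    by (simp add: energy_eq inner_eq field_simps) (simp add: o_def mult.commute)
  moreover have "f \<in> L2 Y \<longleftrightarrow> (\<lambda>x. 1 / r * f (F x)) \<in> L2 X"
    using r L2_cmult_iff[of "1 / r" "\<lambda>x. f (F x)" X] by (simp add: L2_iff o_def)
  ultimately show ?thesis by (simp add: neg_laplacian_def form_domain_iff)
qed

text \<open>In a relational power the intermediate functions are hidden under existential
  quantifiers. The one after \<open>k\<close> steps is composed with \<open>F\<close> and multiplied
  by \<open>1 / r ^ k\<close>, a surjective substitution.\<close>

lemma neg_laplacian_power_iff:
  "(neg_laplacian Y ^^ k) u f \<longleftrightarrow> (neg_laplacian X ^^ k) (u \<circ> F) (\<lambda>x. 1 / r ^ k * f (F x))"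
proof (induction k arbitrary: f)
  case 0
  have "u = f \<longleftrightarrow> u \<circ> F = f \<circ> F" by (metis comp_inv_F(2))
  then show ?case by (simp add: o_def)
next
  case (Suc k)
  have *: "neg_laplacian Y g f \<longleftrightarrow>
      neg_laplacian X (\<lambda>x. 1 / r ^ k * g (F x)) (\<lambda>x. 1 / r ^ Suc k * f (F x))" for g
    using neg_laplacian_cmult_iff[of "1 / r ^ k" "g \<circ> F" "\<lambda>x. 1 / r * f (F x)"] r
    by (simp add: neg_laplacian_iff o_def mult.commute)
  have "surj (\<lambda>g x. 1 / r ^ k * g (F x))"
    by (rule surjI[of _ "\<lambda>f x. r ^ k * f (inv F x)"]) (use r in simp)
  from ex_surj_iff[OF this] have "(\<exists>g. (neg_laplacian X ^^ k) (u \<circ> F) g \<and> neg_laplacian X g (\<lambda>x. 1 / r ^ Suc k * f (F x))) \<longleftrightarrow>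
      (\<exists>g. (neg_laplacian Y ^^ k) u g \<and> neg_laplacian Y g f)"
    unfolding Suc.IH * by simp
  then show ?case unfolding relpowp.simps OO_def by simp
qed

text \<open>The factor \<open>sqrt a\<close> renormalises: if \<open>\<phi> k\<close> has norm 1 on
  \<open>Y\<close>, then \<open>\<phi> k \<circ> F\<close> has squared norm \<open>1 / a\<close> on
  \<open>X\<close>. Eigenfunction expansions then correspond term by term.\<close>

lemma eigenbasis_iff:
  "eigenbasis Y lam \<phi> \<longleftrightarrow> eigenbasis X (\<lambda>k. lam k / r) (\<lambda>k x. sqrt a * \<phi> k (F x))"
proof -
  let ?\<psi> = "\<lambda>k x. sqrt a * \<phi> k (F x)"
  have 1: "(\<forall>k. 0 < lam k) \<longleftrightarrow> (\<forall>k. 0 < lam k / r)" "mono lam \<longleftrightarrow> mono (\<lambda>k. lam k / r)"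
    using r by (auto simp: mono_def field_simps)
  have 2: "neg_laplacian Y (\<phi> k) (\<lambda>x. lam k * \<phi> k x) \<longleftrightarrow>
      neg_laplacian X (?\<psi> k) (\<lambda>x. lam k / r * ?\<psi> k x)" for k
    using neg_laplacian_cmult_iff[of "sqrt a" "\<phi> k \<circ> F" "\<lambda>x. lam k / r * \<phi> k (F x)"] a
    by (simp add: neg_laplacian_iff o_def ac_simps)
  have 3: "L2_inner Y f (\<phi> k) = sqrt a * L2_inner X (f \<circ> F) (?\<psi> k)" for f k
    using a by (simp add: inner_eq L2_inner_cmult_right o_def flip: mult.assoc)
  have 4: "L2_inner X (?\<psi> j) (?\<psi> k) = L2_inner Y (\<phi> j) (\<phi> k)" for j k
    using a unfolding 3 by (simp add: o_def L2_inner_cmult_left)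
  have 5: "L2_norm Y (\<lambda>x. f x - (\<Sum>k<N. L2_inner Y f (\<phi> k) * \<phi> k x)) =
      sqrt a * L2_norm X (\<lambda>x. (f \<circ> F) x - (\<Sum>k<N. L2_inner X (f \<circ> F) (?\<psi> k) * ?\<psi> k x))" for f N
    unfolding norm_eq 3 by (simp add: o_def ac_simps)
  have "(\<forall>f\<in>L2 Y. (\<lambda>N. L2_norm Y (\<lambda>x. f x - (\<Sum>k<N. L2_inner Y f (\<phi> k) * \<phi> k x))) \<longlonglongrightarrow> 0) \<longleftrightarrow>
      (\<forall>f\<in>L2 X. (\<lambda>N. L2_norm X (\<lambda>x. f x - (\<Sum>k<N. L2_inner X f (?\<psi> k) * ?\<psi> k x))) \<longlonglongrightarrow> 0)"
    (is "?l \<longleftrightarrow> (\<forall>f\<in>L2 X. ?P f)")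
  proof -
    have "?l \<longleftrightarrow> (\<forall>f\<in>L2 Y. ?P (f \<circ> F))"
      unfolding 5 using a by (simp add: tendsto_mult_left_iff[of "sqrt a" _ 0, simplified])
    also have "\<dots> \<longleftrightarrow> (\<forall>f\<in>L2 X. ?P f)"
      by (rule ball_comp_F[OF L2_iff])
    finally show ?thesis .
  qed
  then show ?thesis unfolding eigenbasis_def 1 2 4 by simp
qed

text \<open>Test functions and representing sequences are defined through some eigenbasis. The
  correspondence of bases is onto, so such a definition on \<open>X\<close> can be rewritten with
  the bases of \<open>Y\<close>.\<close>

lemma ex_eigenbasis_iff:
  "(\<exists>lam \<phi>. eigenbasis X lam \<phi> \<and> Q lam \<phi>) \<longleftrightarrow>
   (\<exists>lam \<phi>. eigenbasis Y lam \<phi> \<and> Q (\<lambda>k. lam k / r) (\<lambda>k x. sqrt a * \<phi> k (F x)))"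
proof -
  have 1: "surj (\<lambda>lam' k. lam' k / r)"
    by (rule surjI[of _ "\<lambda>lam k. lam k * r"]) (use r in simp)
  have 2: "surj (\<lambda>\<phi>' k x. sqrt a * \<phi>' k (F x))"
    by (rule surjI[of _ "\<lambda>\<phi> k x. \<phi> k (inv F x) / sqrt a"]) (use a in simp)
  show ?thesis
    unfolding eigenbasis_iff
      ex_surj_iff[OF 1, of "\<lambda>lam. \<exists>\<phi>. eigenbasis X lam \<phi> \<and> Q lam \<phi>"]
    by (intro ex_cong1 ex_surj_iff[OF 2])
qed

lemma inner_eigenfunction:
  "L2_inner X (f \<circ> F) (\<lambda>x. sqrt a * \<phi> (F x)) = L2_inner Y f \<phi> / sqrt a"
proof -
  have "sqrt a * z = a * z / sqrt a" for z
    using a by (simp add: eq_divide_eq)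
  then show ?thesis
    unfolding L2_inner_cmult_right inner_eq by (simp add: o_def)
qed

section \<open>Test functions and distributions under a similarity\<close>

lemma continuous_iff: "continuous_on (points Y) u \<longleftrightarrow> continuous_on (points X) (u \<circ> F)"
proof
  assume "continuous_on (points Y) u"
  then show "continuous_on (points X) (u \<circ> F)"
    using continuous_on_compose[OF continuous_F] points by simp
next
  assume *: "continuous_on (points X) (u \<circ> F)"
  have "inv F ` points Y = points X" by (auto simp: points image_iff)
  then show "continuous_on (points Y) u"
    using continuous_on_compose[OF continuous_inv, of "u \<circ> F"] * by simp
qed

text \<open>Decay is measured against the index \<open>n\<close>, and the similarity preserves the
  numbering; the coefficients only change by the factor \<open>1 / sqrt a\<close>.\<close>

lemma test_functions_iff: "u \<in> test_functions Y \<longleftrightarrow> u \<circ> F \<in> test_functions X"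
proof -
  have "(\<lambda>n. real (Suc n) ^ k * \<bar>L2_inner X (\<lambda>x. sqrt a * \<phi> n (F x)) (u \<circ> F)\<bar>) \<longlonglongrightarrow> 0 \<longleftrightarrow>
      (\<lambda>n. real (Suc n) ^ k * \<bar>L2_inner Y (\<phi> n) u\<bar>) \<longlonglongrightarrow> 0" for k \<phi>
  proof -
    have "L2_inner X (\<lambda>x. sqrt a * \<phi> n (F x)) (u \<circ> F) = 1 / sqrt a * L2_inner Y (\<phi> n) u" for n
      by (simp add: inner_eigenfunction L2_inner_commute[of _ _ "u \<circ> F"] L2_inner_commute[of _ _ u])
    then have "(\<lambda>n. real (Suc n) ^ k * \<bar>L2_inner X (\<lambda>x. sqrt a * \<phi> n (F x)) (u \<circ> F)\<bar>) =
        (\<lambda>n. 1 / sqrt a * (real (Suc n) ^ k * \<bar>L2_inner Y (\<phi> n) u\<bar>))"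
      using a by (simp add: abs_mult)
    then show ?thesis
      using a tendsto_mult_left_iff[of "1 / sqrt a" "\<lambda>n. real (Suc n) ^ k * \<bar>L2_inner Y (\<phi> n) u\<bar>" 0] by simp
  qed
  then show ?thesis
    unfolding test_functions_def mem_Collect_eq ex_eigenbasis_iff
    by (simp add: continuous_iff boundary)
qed

text \<open>The radius absorbs \<open>sqrt a\<close> from the norm and \<open>r ^ k\<close> from the
  \<open>k\<close>-th power of the Laplacian.\<close>

lemma test_ball_iff:
  "v \<in> test_ball Y k u \<rho> \<longleftrightarrow> v \<circ> F \<in> test_ball X k (u \<circ> F) (\<rho> / (sqrt a * r ^ k))"
proof -
  have n: "L2_norm Y f < \<rho> \<longleftrightarrow> L2_norm X (\<lambda>x. 1 / r ^ k * f (F x)) < \<rho> / (sqrt a * r ^ k)" for f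
    using a r unfolding L2_norm_cmult norm_eq by (simp add: o_def field_simps)
  have "surj (\<lambda>g x. 1 / r ^ k * g (F x))"
    by (rule surjI[of _ "\<lambda>f x. r ^ k * f (inv F x)"]) (use r in simp)
  from ex_surj_iff[OF this, of "\<lambda>f. (neg_laplacian X ^^ k) (\<lambda>x. v (F x) - u (F x)) f \<and>
      L2_norm X f < \<rho> / (sqrt a * r ^ k)"]
  have "(\<exists>f. (neg_laplacian Y ^^ k) (\<lambda>x. v x - u x) f \<and> L2_norm Y f < \<rho>) \<longleftrightarrow>
      (\<exists>f. (neg_laplacian X ^^ k) (\<lambda>x. (v \<circ> F) x - (u \<circ> F) x) f \<and>
        L2_norm X f < \<rho> / (sqrt a * r ^ k))"
    unfolding neg_laplacian_power_iff n by (simp add: o_def)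
  then show ?thesis by (simp add: test_ball_def test_functions_iff)
qed

lemma continuous_map_comp_F:
  "continuous_map (test_topology Y) (test_topology X) (\<lambda>u. u \<circ> F)"
  unfolding test_topology_def[of X]
proof (rule continuous_on_generated_topo)
  fix U assume "U \<in> {test_ball X k u \<rho> |k u \<rho>. u \<in> test_functions X \<and> 0 < \<rho>}"
  then obtain k u \<rho> where U: "U = test_ball X k u \<rho>" and u: "u \<in> test_functions X" "0 < \<rho>"
    by blast
  have B: "(\<lambda>u. u \<circ> F) -` U = test_ball Y k (u \<circ> inv F) (\<rho> * (sqrt a * r ^ k))"
    using a r by (auto simp: U test_ball_iff)
  have "openin (test_topology Y) (test_ball Y k (u \<circ> inv F) (\<rho> * (sqrt a * r ^ k)))"
    unfolding test_topology_def
    by (rule topology_generated_by_Basis) (use a r u in \<open>force simp: test_functions_iff\<close>)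
  then show "openin (test_topology Y) ((\<lambda>u. u \<circ> F) -` U \<inter> topspace (test_topology Y))"
    unfolding B by (intro openin_Int openin_topspace)
next
  show "(\<lambda>u. u \<circ> F) ` topspace (test_topology Y) \<subseteq>
      \<Union> {test_ball X k u \<rho> |k u \<rho>. u \<in> test_functions X \<and> 0 < \<rho>}"
  proof
    fix v assume "v \<in> (\<lambda>u. u \<circ> F) ` topspace (test_topology Y)"
    then obtain k u \<rho> v' where "v = v' \<circ> F" "v' \<in> test_ball Y k u \<rho>" "u \<in> test_functions Y" "0 < \<rho>"
      by (auto simp: test_topology_def)
    then have "v \<in> test_ball X k (u \<circ> F) (\<rho> / (sqrt a * r ^ k))" "u \<circ> F \<in> test_functions X"
      "0 < \<rho> / (sqrt a * r ^ k)"
      using a r by (auto simp: test_ball_iff test_functions_iff)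
    then show "v \<in> \<Union> {test_ball X k u \<rho> |k u \<rho>. u \<in> test_functions X \<and> 0 < \<rho>}"
      by blast
  qed
qed

lemma distributions_push:
  assumes "T \<in> distributions X"
  shows "(\<lambda>u. a * T (u \<circ> F)) \<in> distributions Y"
proof -
  have "continuous_map (test_topology X) euclideanreal T"
    using assms by (simp add: distributions_def)
  from continuous_map_compose[OF continuous_map_comp_F this]
  have "continuous_map (test_topology Y) euclideanreal (\<lambda>u. a * T (u \<circ> F))"
    by (intro continuous_map_real_mult continuous_map_const) (auto simp: o_def)
  moreover have "T (\<lambda>x. u (F x) + v (F x)) = T (u \<circ> F) + T (v \<circ> F)"
    if "u \<in> test_functions Y" "v \<in> test_functions Y" for u v
    using assms that by (simp add: distributions_def test_functions_iff o_def)
  moreover have "T (\<lambda>x. c * u (F x)) = c * T (u \<circ> F)" if "u \<in> test_functions Y" for u c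
    using assms that by (simp add: distributions_def test_functions_iff o_def)
  ultimately show ?thesis by (simp add: distributions_def o_def distrib_left)
qed

section \<open>Sobolev spaces of positive and negative order under a similarity\<close>

lemma sobolev_comp_F:
  assumes "u \<in> sobolev Y s"
  shows "u \<circ> F \<in> sobolev X s"
proof -
  obtain lam \<phi> f where b: "eigenbasis Y lam \<phi>" and f: "f \<in> L2 Y" and u: "u \<in> L2 Y"
    and lim: "(\<lambda>N. L2_norm Y (\<lambda>x. u x - (\<Sum>k<N. lam k powr (- s / 2) * L2_inner Y f (\<phi> k) * \<phi> k x)))
          \<longlonglongrightarrow> 0"
    using assms by (auto simp: sobolev_def)
  \<comment> \<open>The factor in \<open>?g\<close> cancels \<open>r powr (s / 2)\<close>, which
    arises because the eigenvalues become \<open>lam k / r\<close>.\<close>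
  let ?\<psi> = "\<lambda>k x. sqrt a * \<phi> k (F x)" and ?g = "\<lambda>x. r powr (- s / 2) * (f \<circ> F) x"
  have pos: "0 < lam k" for k using b by (simp add: eigenbasis_def)
  have eq: "(lam k / r) powr (- s / 2) * L2_inner X ?g (?\<psi> k) * ?\<psi> k x =
      lam k powr (- s / 2) * L2_inner Y f (\<phi> k) * \<phi> k (F x)" for k x
    using a r pos[of k] unfolding L2_inner_cmult_left inner_eigenfunction
    by (simp add: powr_divide)
  have "(\<lambda>N. L2_norm X (\<lambda>x. (u \<circ> F) x -
      (\<Sum>k<N. (lam k / r) powr (- s / 2) * L2_inner X ?g (?\<psi> k) * ?\<psi> k x))) \<longlonglongrightarrow> 0"
    using lim a unfolding norm_eq eq
    by (simp add: o_def tendsto_mult_left_iff[of "sqrt a" _ 0, simplified])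
  moreover have "?g \<in> L2 X" "u \<circ> F \<in> L2 X"
    using f u L2_cmult[of "f \<circ> F" X] by (auto simp: L2_iff)
  ultimately show ?thesis
    using b unfolding sobolev_def eigenbasis_iff by blast
qed

text \<open>The eigenvalues contribute \<open>r powr s\<close> and the squared coefficients
  \<open>1 / a\<close>. Summability allows this constant to be taken out of
  \<open>suminf\<close>.\<close>

lemma neg_sobolev_norm_eq:
  assumes b: "eigenbasis Y lam \<phi>" and d: "d \<in> L2 Y" and s: "0 < s"
  shows "sobolev_norm X (\<lambda>k. lam k / r) (\<lambda>k x. sqrt a * \<phi> k (F x)) (- s) (d \<circ> F) =
    sqrt (r powr s / a) * sobolev_norm Y lam \<phi> (- s) d"
proof -
  have pos: "0 < lam k" for k using b by (simp add: eigenbasis_def)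
  have "(lam k / r) powr (- s) * (L2_inner X (d \<circ> F) (\<lambda>x. sqrt a * \<phi> k (F x)))\<^sup>2 =
      r powr s / a * (lam k powr (- s) * (L2_inner Y d (\<phi> k))\<^sup>2)" for k
    using a r pos[of k] unfolding inner_eigenfunction
    by (simp add: powr_divide powr_minus power_divide field_simps)
  then show ?thesis
    unfolding sobolev_norm_def
    by (simp only: suminf_mult[OF summable_neg_sobolev_norm[OF b d s]] real_sqrt_mult)
qed

text \<open>\<open>represents\<close> sees a functional only through test functions, so
  \<open>S\<close> is prescribed only there and may be built from \<open>dual_pairing\<close>. The
  two negative norms differ by a positive constant, to which the Cauchy condition is
  insensitive.\<close>

lemma represents_iff:
  assumes s: "0 < s" and S: "\<And>u. u \<in> test_functions Y \<Longrightarrow> S u = a * T (u \<circ> F)"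
  shows "represents Y s v S \<longleftrightarrow> represents X s (\<lambda>j. v j \<circ> F) T"
proof (cases "\<forall>j. v j \<in> L2 Y")
  case False
  then show ?thesis by (auto simp: represents_def L2_iff)
next
  case v: True
  let ?C = "\<lambda>q. \<forall>e>0::real. \<exists>N. \<forall>i\<ge>N. \<forall>j\<ge>N. q i j < e"
  have scale: "?C (\<lambda>i j. c * q i j) \<longleftrightarrow> ?C q" if "0 < c" for c :: real and q :: "nat \<Rightarrow> nat \<Rightarrow> real"
  proof (intro iffI allI impI)
    fix e :: real assume *: "?C (\<lambda>i j. c * q i j)" and "0 < e"
    with that have "0 < c * e" by simp
    with * have "\<exists>N. \<forall>i\<ge>N. \<forall>j\<ge>N. c * q i j < c * e" by blast
    then show "\<exists>N. \<forall>i\<ge>N. \<forall>j\<ge>N. q i j < e" using that by simp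
  next
    fix e :: real assume *: "?C q" and "0 < e"
    with that have "0 < e / c" by simp
    with * have "\<exists>N. \<forall>i\<ge>N. \<forall>j\<ge>N. q i j < e / c" by blast
    then show "\<exists>N. \<forall>i\<ge>N. \<forall>j\<ge>N. c * q i j < e" using that by (simp add: field_simps)
  qed
  have "?C (\<lambda>i j. sobolev_norm X (\<lambda>k. lam k / r) (\<lambda>k x. sqrt a * \<phi> k (F x)) (- s)
        (\<lambda>x. (v i \<circ> F) x - (v j \<circ> F) x)) \<longleftrightarrow>
      ?C (\<lambda>i j. sobolev_norm Y lam \<phi> (- s) (\<lambda>x. v i x - v j x))" if "eigenbasis Y lam \<phi>" for lam \<phi>
  proof -
    have "sobolev_norm X (\<lambda>k. lam k / r) (\<lambda>k x. sqrt a * \<phi> k (F x)) (- s)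
        (\<lambda>x. (v i \<circ> F) x - (v j \<circ> F) x) =
        sqrt (r powr s / a) * sobolev_norm Y lam \<phi> (- s) (\<lambda>x. v i x - v j x)" for i j
      using neg_sobolev_norm_eq[OF that L2_diff s, of "v i" "v j"] v by (simp add: o_def)
    then show ?thesis
      using scale[of "sqrt (r powr s / a)"] a r by simp
  qed
  moreover have "(\<forall>u\<in>test_functions Y. (\<lambda>j. L2_inner Y (v j) u) \<longlonglongrightarrow> S u) \<longleftrightarrow>
      (\<forall>u\<in>test_functions X. (\<lambda>j. L2_inner X (v j \<circ> F) u) \<longlonglongrightarrow> T u)"
  proof -
    have "(\<forall>u\<in>test_functions Y. (\<lambda>j. L2_inner Y (v j) u) \<longlonglongrightarrow> S u) \<longleftrightarrow>
        (\<forall>u\<in>test_functions Y. (\<lambda>j. L2_inner X (v j \<circ> F) (u \<circ> F)) \<longlonglongrightarrow> T (u \<circ> F))"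
      using a by (simp add: S inner_eq tendsto_mult_left_iff)
    also have "\<dots> \<longleftrightarrow> (\<forall>u\<in>test_functions X. (\<lambda>j. L2_inner X (v j \<circ> F) u) \<longlonglongrightarrow> T u)"
      by (rule ball_comp_F[OF test_functions_iff])
    finally show ?thesis .
  qed
  ultimately show ?thesis
    unfolding represents_def ex_eigenbasis_iff L2_iff by blast
qed

section \<open>Heat kernel and Riesz kernel under a similarity\<close>

lemma heat_kernel_push:
  assumes q: "heat_kernel X q"
  shows "heat_kernel Y (\<lambda>t x y. q (r * t) (inv F x) (inv F y) / a)" (is "heat_kernel Y ?q")
proof -
  \<comment> \<open>Dividing the kernel by \<open>a\<close> compensates the factor \<open>a\<close>
    of \<open>integral_eq\<close>, so only time is rescaled.\<close>
  have flow: "heat_flow Y ?q f t = heat_flow X q (f \<circ> F) (r * t) \<circ> inv F" for f t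
    using a by (simp add: heat_flow_def integral_eq fun_eq_iff)
  have inv_points: "inv F x \<in> points X" if "x \<in> points Y" for x
    using that by (auto simp: points)
  have "continuous_on ({0<..} \<times> points Y \<times> points Y)
      ((\<lambda>(t, x, y). q t x y) \<circ> (\<lambda>z. (r * fst z, inv F (fst (snd z)), inv F (snd (snd z)))))"
  proof (rule continuous_on_compose)
    show "continuous_on ({0<..} \<times> points Y \<times> points Y)
        (\<lambda>z. (r * fst z, inv F (fst (snd z)), inv F (snd (snd z))))"
      by (intro continuous_intros continuous_on_compose2[OF continuous_inv]) auto
    show "continuous_on ((\<lambda>z. (r * fst z, inv F (fst (snd z)), inv F (snd (snd z)))) `
        ({0<..} \<times> points Y \<times> points Y)) (\<lambda>(t, x, y). q t x y)"
      using q r by (auto simp: heat_kernel_def inv_points elim!: continuous_on_subset)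
  qed
  from continuous_on_divide[OF this continuous_on_const[of _ a]] a
  have "continuous_on ({0<..} \<times> points Y \<times> points Y) (\<lambda>(t, x, y). ?q t x y)"
    by (simp add: case_prod_unfold o_def)
  moreover have "\<exists>g. neg_laplacian Y (heat_flow Y ?q f t) g \<and>
      ((\<lambda>s. L2_norm Y (\<lambda>x. (heat_flow Y ?q f s x - heat_flow Y ?q f t x) / (s - t) - (- g x)))
        \<longlongrightarrow> 0) (at t)" if f: "f \<in> L2 Y" and t: "0 < t" for f t
  proof -
    let ?u = "heat_flow X q (f \<circ> F)"
    have "f \<circ> F \<in> L2 X" "0 < r * t" using f t r by (auto simp: L2_iff)
    then obtain g where g: "neg_laplacian X (?u (r * t)) g" and
      lim: "((\<lambda>s. L2_norm X (\<lambda>x. (?u s x - ?u (r * t) x) / (s - r * t) - (- g x))) \<longlongrightarrow> 0) (at (r * t))"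
      using q unfolding heat_kernel_def by blast
    \<comment> \<open>Chain rule: differentiating the flow at time \<open>r * t\<close> yields the
      factor \<open>r\<close>, the same one as in \<open>neg_laplacian_iff\<close>.\<close>
    let ?g = "\<lambda>x. r * g (inv F x)"
    have "filterlim (\<lambda>s. r * s) (at (r * t)) (at t)"
      using r by (intro filterlim_atI tendsto_intros) (auto simp: eventually_at_filter)
    from filterlim_compose[OF lim this]
    have "((\<lambda>s. sqrt a * r * L2_norm X (\<lambda>x. (?u (r * s) x - ?u (r * t) x) / (r * s - r * t) - (- g x)))
        \<longlongrightarrow> 0) (at t)"
      by (rule tendsto_mult_right_zero)
    moreover have "L2_norm Y (\<lambda>x. (heat_flow Y ?q f s x - heat_flow Y ?q f t x) / (s - t) - (- ?g x)) =
        sqrt a * r * L2_norm X (\<lambda>x. (?u (r * s) x - ?u (r * t) x) / (r * s - r * t) - (- g x))" for s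
    proof -
      have "r * (z / (r * s - r * t)) = z / (s - t)" for z
        using r by (simp flip: right_diff_distrib)
      then have "(z / (s - t) - (- (r * y))) = r * (z / (r * s - r * t) - (- y))" for y z
        by (simp only: right_diff_distrib mult_minus_right)
      then have "L2_norm Y (\<lambda>x. (heat_flow Y ?q f s x - heat_flow Y ?q f t x) / (s - t) - (- ?g x)) =
          sqrt a * L2_norm X (\<lambda>x. r * ((?u (r * s) x - ?u (r * t) x) / (r * s - r * t) - (- g x)))"
        unfolding norm_eq flow by (simp add: o_def)
      then show ?thesis using r unfolding L2_norm_cmult by simp
    qed
    ultimately have "((\<lambda>s. L2_norm Y (\<lambda>x. (heat_flow Y ?q f s x - heat_flow Y ?q f t x) / (s - t) -
        (- ?g x))) \<longlongrightarrow> 0) (at t)" by simp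
    moreover have "neg_laplacian Y (heat_flow Y ?q f t) ?g"
      using g r by (simp add: neg_laplacian_iff flow)
    ultimately show ?thesis by blast
  qed
  moreover have "((\<lambda>t. L2_norm Y (\<lambda>x. heat_flow Y ?q f t x - f x)) \<longlongrightarrow> 0) (at_right 0)"
    if f: "f \<in> L2 Y" for f
  proof -
    have lim: "((\<lambda>t. L2_norm X (\<lambda>x. heat_flow X q (f \<circ> F) t x - (f \<circ> F) x)) \<longlongrightarrow> 0) (at_right 0)"
      using q f unfolding heat_kernel_def L2_iff by blast
    have "filterlim (\<lambda>s. r * s) (at_right 0) (at_right 0)"
      using filtermap_times_pos_at_right[OF r, of 0] by (simp add: filterlim_def)
    from tendsto_mult_right_zero[OF filterlim_compose[OF lim this], of "sqrt a"]
    show ?thesis unfolding norm_eq flow by (simp add: o_def)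
  qed
  ultimately show ?thesis by (simp add: heat_kernel_def)
qed

lemma riesz_kernel_push:
  "riesz_kernel (\<lambda>t x y. q (r * t) (inv F x) (inv F y) / a) s x y =
    r powr (- s / 2) / a * riesz_kernel q s (inv F x) (inv F y)"
proof -
  let ?f = "\<lambda>t. indicator {0<..} t * (t powr (s / 2 - 1) * q t (inv F x) (inv F y))"
  \<comment> \<open>The substitution gives one factor \<open>r\<close> from the measure and
    \<open>r powr (s / 2 - 1)\<close> from the power of \<open>t\<close>. It covers divergent
    integrals too, both sides being 0.\<close>
  have "(\<integral>t. ?f t \<partial>lborel) = r * (\<integral>t. ?f (r * t) \<partial>lborel)"
    using lborel_integral_real_affine[of r ?f 0] r by simp
  also have "(\<lambda>t. ?f (r * t)) = (\<lambda>t. r powr (s / 2 - 1) *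
      (indicator {0<..} t * (t powr (s / 2 - 1) * q (r * t) (inv F x) (inv F y))))"
    using r by (auto simp: fun_eq_iff indicator_def zero_less_mult_iff powr_mult)
  finally have *: "(\<integral>t. ?f t \<partial>lborel) = r powr (s / 2) *
      (\<integral>t. indicator {0<..} t * (t powr (s / 2 - 1) * q (r * t) (inv F x) (inv F y)) \<partial>lborel)"
    using r unfolding integral_mult_right_zero by (simp add: powr_diff)
  then show ?thesis
    using a r by (simp add: riesz_kernel_def set_lebesgue_integral_def powr_minus field_simps)
qed

end

section \<open>Transport of the Gaussian field and of its pairings\<close>

lemma (in prob_space) centered_gaussian_cmult:
  assumes "centered_gaussian M Z" "c \<noteq> 0"
  shows "centered_gaussian M (\<lambda>\<omega>. c * Z \<omega>)"
proof (cases "AE \<omega> in M. Z \<omega> = 0")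
  case True
  with assms show ?thesis by (auto simp: centered_gaussian_def)
next
  case False
  then obtain \<sigma> where \<sigma>: "0 < \<sigma>" "distributed M lborel Z (normal_density 0 \<sigma>)"
    using assms by (auto simp: centered_gaussian_def)
  then have "distributed M lborel (\<lambda>\<omega>. c * Z \<omega>) (normal_density 0 (\<bar>c\<bar> * \<sigma>))"
    using normal_density_affine[of Z 0 \<sigma> c 0] assms(2) by simp
  moreover have "0 < \<bar>c\<bar> * \<sigma>" using \<sigma> assms(2) by simp
  moreover have "(\<lambda>\<omega>. c * Z \<omega>) \<in> borel_measurable M"
    using assms(1) by (auto simp: centered_gaussian_def)
  ultimately show ?thesis
    unfolding centered_gaussian_def by blast
qed

context form_similarity
begin

text \<open>The assumption says exactly that the factor in \<open>riesz_kernel_push\<close> is 1, so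
  only the \<open>a\<close> of each of the two integrals survives.\<close>

lemma riesz_covariance_push:
  assumes "r powr (s / 2) * a = 1"
  shows "(\<integral>x. (\<integral>y. riesz_kernel (\<lambda>t x y. q (r * t) (inv F x) (inv F y) / a) s x y * u x * v y \<partial>msr Y) \<partial>msr Y) =
    a\<^sup>2 * (\<integral>x. (\<integral>y. riesz_kernel q s x y * u (F x) * v (F y) \<partial>msr X) \<partial>msr X)"
proof -
  have "r powr (- s / 2) / a = 1"
    using assms a r by (simp add: powr_minus field_simps)
  then show ?thesis
    unfolding riesz_kernel_push integral_eq inv_F by (simp add: power2_eq_square)
qed

lemma fgff_push:
  assumes "prob_space P" and h: "fgff X P h" and scaling: "r powr (d_S / 2) * a = 1"
  shows "fgff Y P (\<lambda>\<omega> u. a * dual_pairing X s (h \<omega>) (u \<circ> F))"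
proof -
  interpret P: prob_space P by fact
  \<comment> \<open>On test functions the pairing is evaluation of \<open>h \<omega>\<close>, so
    Gaussianity and covariance are inherited from \<open>h\<close> for any \<open>s\<close>.\<close>
  have pairing: "dual_pairing X s (h \<omega>) (u \<circ> F) = h \<omega> (u \<circ> F)" if "u \<in> test_functions Y" for u \<omega>
    using that by (simp add: dual_pairing_test_function test_functions_iff)
  have "(\<lambda>u. a * dual_pairing X s (h \<omega>) (u \<circ> F)) \<in> distributions Y" if "\<omega> \<in> space P" for \<omega>
    using h that by (intro distributions_push dual_pairing_distribution)
      (simp add: fgff_def gaussian_random_distribution_def)
  moreover have "centered_gaussian P (\<lambda>\<omega>. a * dual_pairing X s (h \<omega>) (u \<circ> F))"
    if "u \<in> test_functions Y" for u
    using h that a unfolding pairing[OF that]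
    by (intro P.centered_gaussian_cmult)
      (auto simp: fgff_def gaussian_random_distribution_def test_functions_iff)
  moreover obtain q where q: "heat_kernel X q" and
    cov: "\<And>u v. u \<in> test_functions X \<Longrightarrow> v \<in> test_functions X \<Longrightarrow> (\<integral>\<omega>. h \<omega> u * h \<omega> v \<partial>P) =
           (\<integral>x. (\<integral>y. riesz_kernel q d_S x y * u x * v y \<partial>msr X) \<partial>msr X)"
    using h by (auto simp: fgff_def)
  have "(\<integral>\<omega>. a * dual_pairing X s (h \<omega>) (u \<circ> F) * (a * dual_pairing X s (h \<omega>) (v \<circ> F)) \<partial>P) =
      (\<integral>x. (\<integral>y. riesz_kernel (\<lambda>t x y. q (r * t) (inv F x) (inv F y) / a) d_S x y * u x * v y
        \<partial>msr Y) \<partial>msr Y)"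
    if uv: "u \<in> test_functions Y" "v \<in> test_functions Y" for u v
  proof -
    have "(\<integral>\<omega>. a * dual_pairing X s (h \<omega>) (u \<circ> F) * (a * dual_pairing X s (h \<omega>) (v \<circ> F)) \<partial>P) =
        (\<integral>\<omega>. a\<^sup>2 * (h \<omega> (u \<circ> F) * h \<omega> (v \<circ> F)) \<partial>P)"
      by (simp add: pairing uv power2_eq_square ac_simps)
    also have "\<dots> = a\<^sup>2 * (\<integral>\<omega>. h \<omega> (u \<circ> F) * h \<omega> (v \<circ> F) \<partial>P)"
      by (rule integral_mult_right_zero)
    also have "\<dots> = a\<^sup>2 * (\<integral>x. (\<integral>y. riesz_kernel q d_S x y * u (F x) * v (F y) \<partial>msr X) \<partial>msr X)"
      using uv by (simp add: cov test_functions_iff)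
    finally show ?thesis by (simp only: riesz_covariance_push[OF scaling])
  qed
  ultimately show ?thesis
    unfolding fgff_def gaussian_random_distribution_def using heat_kernel_push[OF q] by blast
qed

lemma neg_sobolev_push:
  assumes T: "T \<in> neg_sobolev X s" and s: "0 < s"
  shows "(\<lambda>u. a * dual_pairing X s T (u \<circ> F)) \<in> neg_sobolev Y s" (is "?S \<in> _")
proof -
  obtain v where "represents X s v T" using T by (auto simp: neg_sobolev_def)
  then have "represents X s (\<lambda>j. v j \<circ> inv F \<circ> F) T" by simp
  then have "represents Y s (\<lambda>j. v j \<circ> inv F) ?S"
    by (subst represents_iff[OF s, where T = T])
      (auto simp: dual_pairing_test_function test_functions_iff)
  moreover have "?S \<in> distributions Y"
    using T by (intro distributions_push dual_pairing_distribution) (simp add: neg_sobolev_def)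
  ultimately show ?thesis by (auto simp: neg_sobolev_def)
qed

text \<open>Composition with \<open>F\<close> turns sequences that represent the pushed field into
  sequences that represent \<open>T\<close>. All of those have one common limit against
  \<open>u \<circ> F\<close>, so every sequence on the cell has that limit times
  \<open>a\<close>.\<close>

lemma dual_pairing_push:
  assumes T: "T \<in> neg_sobolev X s" and s: "0 < s" and u: "u \<in> sobolev Y s"
  shows "dual_pairing Y s (\<lambda>u. a * dual_pairing X s T (u \<circ> F)) u = a * dual_pairing X s T (u \<circ> F)"
    (is "dual_pairing Y s ?S u = _")
proof (rule dual_pairing_eqI)
  show "?S \<in> neg_sobolev Y s" using T s by (rule neg_sobolev_push)
  fix v assume "represents Y s v ?S"
  then have v: "represents X s (\<lambda>j. v j \<circ> F) T"
    by (subst (asm) represents_iff[OF s, where T = T])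
      (auto simp: dual_pairing_test_function test_functions_iff)
  obtain l where l: "\<And>v. represents X s v T \<Longrightarrow> (\<lambda>j. L2_inner X (v j) (u \<circ> F)) \<longlonglongrightarrow> l"
    using pairing_well_defined[OF sobolev_comp_F[OF u] s] by blast
  have "dual_pairing X s T (u \<circ> F) = l" by (rule dual_pairing_eqI[OF T l])
  with l[OF v] show "(\<lambda>j. L2_inner Y (v j) u) \<longlonglongrightarrow> ?S u"
    by (auto simp: inner_eq intro!: tendsto_intros)
qed

end


section \<open>The gasket and its cells\<close>

lemma graph_energy_commute: "graph_energy p n u v = graph_energy p n v u"
  by (simp add: graph_energy_def mult.commute)

lemma graph_energy_cmult_left: "graph_energy p n (\<lambda>x. c * u x) v = c * graph_energy p n u v"
  by (simp add: graph_energy_def sum_distrib_left case_prod_unfold ac_simps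
      flip: right_diff_distrib)

lemma graph_energy_cmult_right: "graph_energy p n u (\<lambda>x. c * v x) = c * graph_energy p n u v"
  by (metis graph_energy_cmult_left graph_energy_commute)

lemma bij_word_map: "bij (word_map p w)"
proof -
  have surj_contr: "surj (contr p i)" for i
    by (rule surjI[of _ "\<lambda>y. 2 *\<^sub>R y - p i"]) (simp add: contr_def scaleR_diff_right)
  have "surj (word_map p w)"
  proof (induction w)
    case (Cons i w)
    from comp_surj[OF this surj_contr] show ?case by (simp only: word_map.simps)
  qed simp
  then show ?thesis by (simp add: bij_def inj_word_map)
qed

lemma scale_measure_eq_density: "scale_measure c M = density M (\<lambda>_. c)"
  by (rule measure_eqI) (auto simp: emeasure_density_const)

locale gasket =
  fixes p :: "nat \<Rightarrow> plane" and K :: "plane set" and \<mu> :: "plane measure"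
  assumes gasket: "is_gasket p K" and self_similar: "is_self_similar_measure p K \<mu>"
begin

lemma sets_\<mu>: "sets \<mu> = sets (restrict_space borel K)"
  using self_similar by (simp add: is_self_similar_measure_def)

lemma space_\<mu>: "space \<mu> = K"
  using sets_eq_imp_space_eq[OF sets_\<mu>] by (simp add: space_restrict_space)

sublocale prob_space \<mu>
  using self_similar by (simp add: is_self_similar_measure_def)

lemma continuous_in_L2: "continuous_on K u \<Longrightarrow> u \<in> L2 (gasket_space p K \<mu>)"
proof -
  assume u: "continuous_on K u"
  have meas: "u \<in> borel_measurable \<mu>"
    using borel_measurable_continuous_on_restrict[OF u] by (simp add: measurable_cong_sets[OF sets_\<mu>])
  have "compact (u ` K)"
    using u gasket by (simp add: compact_continuous_image is_gasket_def)
  then obtain B where B: "\<And>x. x \<in> K \<Longrightarrow> \<bar>u x\<bar> \<le> B"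
    by (force dest!: compact_imp_bounded simp: bounded_iff)
  have "integrable \<mu> (\<lambda>x. (u x)\<^sup>2)"
  proof (rule integrable_const_bound)
    show "AE x in \<mu>. norm ((u x)\<^sup>2) \<le> B\<^sup>2"
      using power_mono[OF B abs_ge_zero, of _ 2] by (intro AE_I2) (simp add: space_\<mu>)
  qed (use meas in measurable)
  with meas show ?thesis by (simp add: L2_def gasket_space_def)
qed

sublocale form: symmetric_form "gasket_space p K \<mu>"
proof
  let ?X = "gasket_space p K \<mu>"
  show "energy ?X u v = energy ?X v u" for u v
    by (simp add: gasket_space_def gasket_energy_def graph_energy_commute)
  show "u \<in> form_domain ?X \<Longrightarrow> continuous_on (points ?X) u" for u
    by (simp add: gasket_space_def gasket_domain_def)
  show "u \<in> form_domain ?X \<Longrightarrow> x \<in> boundary ?X \<Longrightarrow> u x = 0" for u x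
    by (simp add: gasket_space_def gasket_domain_def)
  show "continuous_on (points ?X) u \<Longrightarrow> u \<in> L2 ?X" for u
    by (rule continuous_in_L2) (simp add: gasket_space_def)
  \<comment> \<open>The two sequences under \<open>lim\<close> coincide term by term, so the
    equality holds whether or not they converge.\<close>
  show "energy ?X (\<lambda>x. c * u x) v = energy ?X u (\<lambda>x. c * v x)" for c u v
    by (simp add: gasket_space_def gasket_energy_def graph_energy_cmult_left graph_energy_cmult_right)
  show "u \<in> form_domain ?X \<Longrightarrow> (\<lambda>x. c * u x) \<in> form_domain ?X" for c u
    by (auto simp: gasket_space_def gasket_domain_def graph_energy_cmult_left
        graph_energy_cmult_right intro!: continuous_intros convergent_mult convergent_const)
qed

text \<open>With \<open>a = (1/3) ^ length w\<close> from the measure, \<open>r\<close> is dictated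
  by \<open>r * a = (5/3) ^ length w\<close>.\<close>

sublocale cell: form_similarity "gasket_space p K \<mu>" "cell_space p K \<mu> w" "word_map p w"
  "(1/3) ^ length w" "5 ^ length w" for w
proof
  let ?X = "gasket_space p K \<mu>" and ?Y = "cell_space p K \<mu> w" and ?F = "word_map p w"
  let ?N = "restrict_space borel (?F ` K)" and ?a = "(1/3::real) ^ length w"
  have F: "?F \<in> measurable \<mu> ?N"
    using borel_measurable_continuous_on_restrict[OF continuous_on_word_map[of K p w]]
    by (intro measurable_restrict_space2) (auto simp: space_\<mu> measurable_cong_sets[OF sets_\<mu>])
  have "inv ?F \<in> measurable ?N (restrict_space borel K)"
    using borel_measurable_continuous_on_restrict[OF continuous_on_inv_word_map[of p w K]]
    by (intro measurable_restrict_space2) (auto simp: space_restrict_space inj_word_map)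
  then have G: "inv ?F \<in> measurable ?N \<mu>"
    by (simp add: measurable_cong_sets[OF refl sets_\<mu>])
  show bij: "bij ?F" by (rule bij_word_map)
  have a: "0 < ?a" by simp
  then show "0 < ?a" "(0::real) < 5 ^ length w" by simp_all
  show "points ?Y = ?F ` points ?X" "boundary ?Y = ?F ` boundary ?X"
    by (simp_all add: cell_space_def gasket_space_def)
  show "continuous_on (points ?X) ?F" by (rule continuous_on_word_map)
  show "continuous_on (points ?Y) (inv ?F)"
    by (simp add: cell_space_def continuous_on_inv_word_map)
  have "(5/3) ^ length w = (5::real) ^ length w * ?a" by (simp add: power_divide)
  then show "energy ?Y u v = 5 ^ length w * ?a * energy ?X (u \<circ> ?F) (v \<circ> ?F)" for u v
    by (simp add: cell_space_def gasket_space_def)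
  show "u \<in> form_domain ?Y \<longleftrightarrow> u \<circ> ?F \<in> form_domain ?X" for u
    by (simp add: cell_space_def gasket_space_def)
  have msr: "msr ?Y = density (distr \<mu> ?N ?F) (\<lambda>_. ennreal ?a)"
    by (simp add: cell_space_def cell_measure_def scale_measure_eq_density)
  show meas: "f \<in> borel_measurable (msr ?Y) \<longleftrightarrow> f \<circ> ?F \<in> borel_measurable (msr ?X)"
    for f :: "plane \<Rightarrow> real"
  proof -
    have "f \<circ> ?F \<circ> inv ?F = f" using bij by (auto simp: fun_eq_iff bij_def surj_f_inv_f)
    then have "f \<in> borel_measurable ?N \<longleftrightarrow> f \<circ> ?F \<in> borel_measurable \<mu>"
      using measurable_comp[OF F, of f borel] measurable_comp[OF G, of "f \<circ> ?F" borel]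
      by (simp only:) blast
    then show ?thesis by (simp add: msr gasket_space_def)
  qed
  \<comment> \<open>Measurability is assumed first, as the rules for \<open>density\<close> and
    \<open>distr\<close> ask for it, and is removed afterwards.\<close>
  have integrable: "integrable (msr ?Y) f \<longleftrightarrow> integrable (msr ?X) (f \<circ> ?F)"
    and integral: "(\<integral>x. f x \<partial>msr ?Y) = ?a * (\<integral>x. f (?F x) \<partial>msr ?X)"
    if "f \<in> borel_measurable (msr ?Y)" for f :: "plane \<Rightarrow> real"
  proof -
    have f: "f \<in> borel_measurable ?N" using that by (simp add: msr)
    show "integrable (msr ?Y) f \<longleftrightarrow> integrable (msr ?X) (f \<circ> ?F)"
      using a f unfolding msr
      by (subst integrable_density) (auto simp: gasket_space_def integrable_distr_eq[OF F f] o_def)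
    show "(\<integral>x. f x \<partial>msr ?Y) = ?a * (\<integral>x. f (?F x) \<partial>msr ?X)"
      using a f unfolding msr
      by (subst integral_density) (auto simp: gasket_space_def integral_distr[OF F f])
  qed
  show integrable_iff: "integrable (msr ?Y) f \<longleftrightarrow> integrable (msr ?X) (f \<circ> ?F)"
    for f :: "plane \<Rightarrow> real"
    using integrable[of f] meas[of f] borel_measurable_integrable by blast
  show "(\<integral>x. f x \<partial>msr ?Y) = ?a * (\<integral>x. f (?F x) \<partial>msr ?X)" for f :: "plane \<Rightarrow> real"
  proof (cases "f \<in> borel_measurable (msr ?Y)")
    \<comment> \<open>A function that is not measurable is integrable on neither side, and both
      integrals take the default value 0.\<close>
    case False
    then have "\<not> integrable (msr ?Y) f" by auto
    moreover from this have "\<not> integrable (msr ?X) (\<lambda>x. f (?F x))"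
      using integrable_iff[of f] by (simp add: o_def)
    ultimately show ?thesis by (simp add: not_integrable_integral_eq)
  qed (rule integral)
qed

end

text \<open>Here \<open>d_S / 2 = ln 3 / ln 5\<close>, the exponent that turns 5 into 3.\<close>

lemma power5_powr_d_S: "(5 ^ n) powr (d_S / 2) * (1 / 3) ^ n = (1::real)"
proof -
  have "(5 ^ n) powr (d_S / 2) = (5 powr (ln 3 / ln 5)) ^ n"
    by (simp add: d_S_def d_H_def d_W_def powr_powr mult.commute flip: powr_realpow)
  also have "5 powr (ln 3 / ln 5) = (3::real)" by (simp add: powr_def)
  finally show ?thesis by (simp flip: power_mult_distrib)
qed

text \<open>\<open>pushed_field\<close> is a formula on all functions, while the pairing of a
  negative Sobolev element is determined by its values on test functions. The second conjunct checks
  that extending from test functions by duality returns the formula.\<close>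

theorem theorem7:
  fixes p :: "nat \<Rightarrow> real ^ 2" and K :: "(real ^ 2) set" and \<mu> :: "(real ^ 2) measure"
    and P :: "'w measure" and h :: "'w \<Rightarrow> (real ^ 2 \<Rightarrow> real) \<Rightarrow> real"
    and n :: nat and w :: "nat list" and \<epsilon> :: real
  assumes "unit_equilateral p"
    and "is_gasket p K"
    and "is_self_similar_measure p K \<mu>"
    and "prob_space P"
    and "fgff (gasket_space p K \<mu>) P h"
    and "n \<ge> 1" and "w \<in> words n"
    and "\<epsilon> > 0"
  shows "fgff (cell_space p K \<mu> w) P (\<lambda>\<omega>. pushed_field p K \<mu> w \<epsilon> (h \<omega>)) \<and>
    (\<forall>\<omega>\<in>space P. h \<omega> \<in> neg_sobolev (gasket_space p K \<mu>) \<epsilon> \<longrightarrow>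
       pushed_field p K \<mu> w \<epsilon> (h \<omega>) \<in> neg_sobolev (cell_space p K \<mu> w) \<epsilon> \<and>
       (\<forall>u\<in>sobolev (cell_space p K \<mu> w) \<epsilon>.
          u \<circ> word_map p w \<in> sobolev (gasket_space p K \<mu>) \<epsilon> \<and>
          dual_pairing (cell_space p K \<mu> w) \<epsilon> (pushed_field p K \<mu> w \<epsilon> (h \<omega>)) u =
            (1/3) ^ n * dual_pairing (gasket_space p K \<mu>) \<epsilon> (h \<omega>) (u \<circ> word_map p w)))"
proof -
  interpret gasket p K \<mu> by unfold_locales fact+
  have n: "length w = n" using \<open>w \<in> words n\<close> by (simp add: words_def)
  have field: "pushed_field p K \<mu> w \<epsilon> T =
      (\<lambda>u. (1/3) ^ length w * dual_pairing (gasket_space p K \<mu>) \<epsilon> T (u \<circ> word_map p w))" for T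
    by (simp add: pushed_field_def fun_eq_iff)
  have "fgff (cell_space p K \<mu> w) P (\<lambda>\<omega>. pushed_field p K \<mu> w \<epsilon> (h \<omega>))"
    unfolding field using assms by (intro cell.fgff_push power5_powr_d_S)
  then show ?thesis
    unfolding field using \<open>0 < \<epsilon>\<close> cell.neg_sobolev_push cell.sobolev_comp_F cell.dual_pairing_push n
    by blast
qed

end
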